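(* Let $Q\in\mathrm{Diff}^1(\mathbb{R})$ be formally self-adjoint and $H=H(Q)=-\partial_x^2+Q$ on $L^2(\mathbb{R})$. For all $N>0$ there is $C_N>0$ such that for all $\rho>1$: if $[\rho^2,\rho^2+\varepsilon]$ is a spectral gap of $H$, then $\varepsilon<C_N\rho^{-N}$.
   Context: $D=-i\partial_x$. $\mathrm{Diff}^1(\mathbb{R})$ is the space of differential operators $Qu=a_1(x)Du+a_0(x)u$ whose coefficients $a_0,a_1$ are smooth and bounded on $\mathbb{R}$ together with all their derivatives. $H(Q)$ is self-adjoint with domain $H^2(\mathbb{R})$. An interval is a spectral gap of $H$ if (its interior) does not meet the spectrum of $H$. *)

theory Defs
  imports "HOL-Analysis.Analysis"
begin

type_synonym cfun = "real \<Rightarrow> complex"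

definition vderiv :: "cfun \<Rightarrow> cfun" where
  "vderiv f = (\<lambda>x. vector_derivative f (at x))"

definition smooth :: "cfun \<Rightarrow> bool" where
  "smooth f \<longleftrightarrow> (\<forall>n. (vderiv ^^ n) f differentiable_on UNIV)"

definition test_fun :: "cfun \<Rightarrow> bool" where
  "test_fun f \<longleftrightarrow> smooth f \<and> compact (closure {x. f x \<noteq> 0})"

text \<open>An operator \<open>Q u = a\<^sub>1 D u + a\<^sub>0 u\<close> with \<open>D = -i d/dx\<close> is encoded by its pair
  \<open>(a\<^sub>1, a\<^sub>0)\<close> of coefficients.\<close>

type_synonym diff_op1 = "cfun \<times> cfun"

definition Diff1 :: "diff_op1 set" where
  "Diff1 = {(a1, a0). \<forall>a\<in>{a1, a0}. smooth a \<and> (\<forall>n. bounded (range ((vderiv ^^ n) a)))}"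

text \<open>The derivative \<open>u'\<close> is passed along with \<open>u\<close>, so that the same formula serves for classical
  and for weak derivatives.\<close>

definition app_op :: "diff_op1 \<Rightarrow> cfun \<Rightarrow> cfun \<Rightarrow> cfun" where
  "app_op Q u u' = (\<lambda>x. fst Q x * (- \<i> * u' x) + snd Q x * u x)"

definition formally_self_adjoint :: "diff_op1 \<Rightarrow> bool" where
  "formally_self_adjoint Q \<longleftrightarrow>
     (\<forall>\<phi> \<psi>. test_fun \<phi> \<longrightarrow> test_fun \<psi> \<longrightarrow>
        (LINT x|lborel. app_op Q \<phi> (vderiv \<phi>) x * cnj (\<psi> x)) =
        (LINT x|lborel. \<phi> x * cnj (app_op Q \<psi> (vderiv \<psi>) x)))"

text \<open>Elements of \<open>L\<^sup>2(\<real>)\<close> are represented by square-integrable functions; equality in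
  \<open>L\<^sup>2(\<real>)\<close> is equality almost everywhere.\<close>

definition L2 :: "cfun set" where
  "L2 = {f. f \<in> borel_measurable lborel \<and> integrable lborel (\<lambda>x. (cmod (f x))\<^sup>2)}"

definition L2_norm :: "cfun \<Rightarrow> real" where
  "L2_norm f = sqrt (LINT x|lborel. (cmod (f x))\<^sup>2)"

definition locally_integrable :: "cfun \<Rightarrow> bool" where
  "locally_integrable f \<longleftrightarrow> (\<forall>K. compact K \<longrightarrow> set_integrable lborel K f)"

definition has_weak_deriv :: "cfun \<Rightarrow> cfun \<Rightarrow> bool" where
  "has_weak_deriv u v \<longleftrightarrow> locally_integrable u \<and> locally_integrable v \<and>
     (\<forall>\<phi>. test_fun \<phi> \<longrightarrow>
        (LINT x|lborel. u x * vderiv \<phi> x) = - (LINT x|lborel. v x * \<phi> x))"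

text \<open>Unbounded operators on \<open>L\<^sup>2(\<real>)\<close> are given by their graphs. The domain of
  \<open>H(Q) = - d\<^sup>2/dx\<^sup>2 + Q\<close> is the Sobolev space \<open>H\<^sup>2(\<real>)\<close>: those \<open>u\<close> in \<open>L\<^sup>2\<close> whose first
  and second weak derivatives exist and lie in \<open>L\<^sup>2\<close>.\<close>

definition H2_derivs :: "cfun \<Rightarrow> cfun \<Rightarrow> cfun \<Rightarrow> bool" where
  "H2_derivs u u' u'' \<longleftrightarrow> u \<in> L2 \<and> u' \<in> L2 \<and> u'' \<in> L2 \<and>
     has_weak_deriv u u' \<and> has_weak_deriv u' u''"

definition H_op :: "diff_op1 \<Rightarrow> (cfun \<times> cfun) set" where
  "H_op Q = {(u, f). f \<in> L2 \<and>
     (\<exists>u' u''. H2_derivs u u' u'' \<and> (AE x in lborel. f x = - u'' x + app_op Q u u' x))}"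

text \<open>A complex number \<open>z\<close> is in the resolvent set of a linear operator \<open>T\<close> if \<open>T - z\<close> is
  injective on the domain of \<open>T\<close>, maps it onto \<open>L\<^sup>2(\<real>)\<close>, and has bounded inverse.\<close>

definition resolvent_set :: "(cfun \<times> cfun) set \<Rightarrow> complex set" where
  "resolvent_set T = {z.
     (\<forall>(u, f)\<in>T. (AE x in lborel. f x - z * u x = 0) \<longrightarrow> (AE x in lborel. u x = 0)) \<and>
     (\<forall>g\<in>L2. \<exists>(u, f)\<in>T. AE x in lborel. f x - z * u x = g x) \<and>
     (\<exists>C. \<forall>(u, f)\<in>T. L2_norm u \<le> C * L2_norm (\<lambda>x. f x - z * u x))}"

definition spectrum :: "(cfun \<times> cfun) set \<Rightarrow> complex set" where
  "spectrum T = - resolvent_set T"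

definition spectral_gap :: "(cfun \<times> cfun) set \<Rightarrow> real set \<Rightarrow> bool" where
  "spectral_gap T J \<longleftrightarrow> complex_of_real ` interior J \<inter> spectrum T = {}"

end

theory Submission
  imports Defs
begin

text \<open>
  Completing the square turns \<open>H\<close> into \<open>(D + b)\<^sup>2 + V\<close> with real smooth \<open>b = a\<^sub>1 / 2\<close> and
  \<open>V = Re a\<^sub>0 - b\<^sup>2\<close>: formal self-adjointness says exactly that \<open>a\<^sub>1\<close> is real and
  \<open>Im a\<^sub>0 = - a\<^sub>1' / 2\<close> (\<open>formally_self_adjoint_coefficients\<close>). For a positive function \<open>P\<close> the
  oscillating function \<open>u = P\<^sup>-\<^sup>1\<^sup>/\<^sup>4 exp (i \<integral> (\<surd>P - b))\<close> satisfies \<open>(H - E) u = r u\<close> with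
  \<open>r = P + P'' / (4 P) - 5 P'\<^sup>2 / (16 P\<^sup>2) + V - E\<close> (\<open>wkb_solution\<close>). For large \<open>E\<close> the equation \<open>r = 0\<close>
  can be solved up to an error \<open>O(E\<^sup>-\<^sup>K)\<close>, uniformly in \<open>x\<close>, by a finite expansion of \<open>P / E\<close> in powers of
  \<open>1 / E\<close>, because all derivatives of \<open>V\<close> are bounded on the whole line (\<open>approximate_phase\<close>).

  The modulus of \<open>u\<close> lies between two positive constants, so \<open>u\<close> is not square-integrable; but cutting it off at
  distance \<open>R\<close> costs an error of squared norm \<open>O(1 / R)\<close>, against a squared norm of \<open>u\<close> of
  order \<open>R\<close>. Hence \<open>E\<close> is, up to \<open>O(E\<^sup>-\<^sup>K)\<close>, an approximate eigenvalue of \<open>H\<close>.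

  Conversely, if the interval of radius \<open>\<delta>\<close> about \<open>E\<close> consists of resolvent points of a symmetric operator, then
  \<open>\<parallel>(H - E) \<phi>\<parallel> \<ge> \<delta> \<parallel>\<phi>\<parallel>\<close> on the domain (\<open>symmetric_gap_lower_bound\<close>). Applied at the midpoint of the gap, this
  bounds the length of the gap by \<open>O(E\<^sup>-\<^sup>K)\<close> (\<open>quasimode_bound\<close>).

  The remaining work is the symmetry of \<open>H\<close> on \<open>H\<^sup>2(\<real>)\<close> (\<open>H_op_symmetric\<close>). It is integration by parts for weak
  derivatives in \<open>L\<^sup>2\<close> (\<open>integration_by_parts_L2\<close>), which rests on smooth cutoffs, on the
  fundamental lemma of the calculus of variations and on Fubini's theorem.
\<close>

section \<open>Square-integrable functions\<close>

definition sqint :: "cfun \<Rightarrow> real" where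
  "sqint f = (LINT x|lborel. (cmod (f x))\<^sup>2)"

lemma sqint_nonneg: "0 \<le> sqint f"
  unfolding sqint_def by simp

lemma L2_norm_sq: "(L2_norm f)\<^sup>2 = sqint f"
  unfolding L2_norm_def sqint_def by simp

lemma L2_measurable [measurable_dest]: "f \<in> L2 \<Longrightarrow> f \<in> borel_measurable lborel"
  by (simp add: L2_def)

lemma sqint_cong_AE:
  assumes "f \<in> L2" "g \<in> L2" "AE x in lborel. f x = g x"
  shows "sqint f = sqint g"
  unfolding sqint_def
proof (rule integral_cong_AE)
  show "(\<lambda>x. (cmod (f x))\<^sup>2) \<in> borel_measurable lborel" "(\<lambda>x. (cmod (g x))\<^sup>2) \<in> borel_measurable lborel"
    using assms(1,2) by measurable
  show "AE x in lborel. (cmod (f x))\<^sup>2 = (cmod (g x))\<^sup>2"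
    using assms(3) by eventually_elim simp
qed

lemma cmod_mult_le_sq: "cmod a * cmod b \<le> (cmod a)\<^sup>2 + (cmod b)\<^sup>2"
proof -
  have "0 \<le> (cmod a - cmod b)\<^sup>2" "0 \<le> cmod a * cmod b" by simp_all
  then show ?thesis unfolding power2_diff by linarith
qed

lemma L2_mult_integrable:
  assumes "f \<in> L2" "g \<in> L2"
  shows "integrable lborel (\<lambda>x. f x * g x)"
proof (rule Bochner_Integration.integrable_bound)
  show "integrable lborel (\<lambda>x. (cmod (f x))\<^sup>2 + (cmod (g x))\<^sup>2)"
    using assms by (auto simp: L2_def)
  show "(\<lambda>x. f x * g x) \<in> borel_measurable lborel"
    using assms by (auto simp: L2_def)
  show "AE x in lborel. norm (f x * g x) \<le> norm ((cmod (f x))\<^sup>2 + (cmod (g x))\<^sup>2)"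
    using cmod_mult_le_sq by (auto simp: norm_mult abs_of_nonneg)
qed

lemma L2_cnj: "f \<in> L2 \<Longrightarrow> (\<lambda>x. cnj (f x)) \<in> L2"
  using borel_measurable_continuous_onI[of cnj]
  unfolding L2_def by (auto intro!: continuous_intros measurable_compose[of f lborel borel cnj])

lemma L2_bounded_mult:
  assumes "f \<in> L2" "a \<in> borel_measurable lborel" "\<And>x. cmod (a x) \<le> C"
  shows "(\<lambda>x. a x * f x) \<in> L2"
proof -
  have "integrable lborel (\<lambda>x. (cmod (a x * f x))\<^sup>2)"
  proof (rule Bochner_Integration.integrable_bound)
    show "integrable lborel (\<lambda>x. C\<^sup>2 * (cmod (f x))\<^sup>2)"
      using assms by (auto simp: L2_def)
    show "(\<lambda>x. (cmod (a x * f x))\<^sup>2) \<in> borel_measurable lborel"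
      using assms by (auto simp: L2_def)
    show "AE x in lborel. norm ((cmod (a x * f x))\<^sup>2) \<le> norm (C\<^sup>2 * (cmod (f x))\<^sup>2)"
      using assms(3) by (auto simp: norm_mult power_mult_distrib intro!: mult_right_mono power_mono)
  qed
  then show ?thesis using assms by (auto simp: L2_def)
qed

lemma L2_cmult: "f \<in> L2 \<Longrightarrow> (\<lambda>x. c * f x) \<in> L2"
  using L2_bounded_mult[of f "\<lambda>_. c" "cmod c"] by simp

lemma cmod_add_sq_le: "(cmod (a + b))\<^sup>2 \<le> 2 * (cmod a)\<^sup>2 + 2 * (cmod b)\<^sup>2"
proof -
  have "(cmod (a + b))\<^sup>2 + (cmod (a - b))\<^sup>2 = 2 * (cmod a)\<^sup>2 + 2 * (cmod b)\<^sup>2"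
    unfolding cmod_power2 by (simp add: power2_eq_square algebra_simps)
  then show ?thesis by (smt (verit) zero_le_power2)
qed

lemma L2_add:
  assumes "f \<in> L2" "g \<in> L2"
  shows "(\<lambda>x. f x + g x) \<in> L2"
proof -
  have "integrable lborel (\<lambda>x. (cmod (f x + g x))\<^sup>2)"
  proof (rule Bochner_Integration.integrable_bound)
    show "integrable lborel (\<lambda>x. 2 * (cmod (f x))\<^sup>2 + 2 * (cmod (g x))\<^sup>2)"
      using assms by (auto simp: L2_def)
    show "(\<lambda>x. (cmod (f x + g x))\<^sup>2) \<in> borel_measurable lborel"
      using assms by (auto simp: L2_def)
    show "AE x in lborel. norm ((cmod (f x + g x))\<^sup>2) \<le> norm (2 * (cmod (f x))\<^sup>2 + 2 * (cmod (g x))\<^sup>2)"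
      using cmod_add_sq_le by auto
  qed
  then show ?thesis using assms by (auto simp: L2_def)
qed

lemma L2_diff: "f \<in> L2 \<Longrightarrow> g \<in> L2 \<Longrightarrow> (\<lambda>x. f x - g x) \<in> L2"
  using L2_add[of f "\<lambda>x. (-1) * g x"] L2_cmult[of g "-1"] by simp

lemma sqint_add_le:
  assumes "f \<in> L2" "g \<in> L2"
  shows "sqint (\<lambda>x. f x + g x) \<le> 2 * sqint f + 2 * sqint g"
proof -
  have "sqint (\<lambda>x. f x + g x) \<le> (LINT x|lborel. 2 * (cmod (f x))\<^sup>2 + 2 * (cmod (g x))\<^sup>2)"
    unfolding sqint_def
    by (rule integral_mono) (use assms L2_add[OF assms] cmod_add_sq_le in \<open>auto simp: L2_def\<close>)
  also have "\<dots> = 2 * sqint f + 2 * sqint g"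
    unfolding sqint_def using assms by (auto simp: L2_def)
  finally show ?thesis .
qed

lemma sqint_cmult: "sqint (\<lambda>x. c * f x) = (cmod c)\<^sup>2 * sqint f"
  unfolding sqint_def by (simp add: norm_mult power_mult_distrib)

lemma sqint_diff:
  assumes "f \<in> L2" "g \<in> L2"
  shows "sqint (\<lambda>x. f x - of_real c * g x)
    = sqint f - 2 * c * Re (LINT x|lborel. f x * cnj (g x)) + c\<^sup>2 * sqint g"
proof -
  have i: "integrable lborel (\<lambda>x. f x * cnj (g x))"
    using L2_mult_integrable[OF assms(1) L2_cnj[OF assms(2)]] .
  have pw: "(cmod (z - of_real c * w))\<^sup>2 = (cmod z)\<^sup>2 - 2 * c * Re (z * cnj w) + c\<^sup>2 * (cmod w)\<^sup>2" for z w
    by (simp only: cmod_power2) (simp add: power2_eq_square algebra_simps)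
  have "sqint (\<lambda>x. f x - of_real c * g x)
    = (LINT x|lborel. (cmod (f x))\<^sup>2 - 2 * c * Re (f x * cnj (g x)) + c\<^sup>2 * (cmod (g x))\<^sup>2)"
    unfolding sqint_def pw ..
  also have "\<dots> = (LINT x|lborel. (cmod (f x))\<^sup>2) - (LINT x|lborel. 2 * c * Re (f x * cnj (g x))) + (LINT x|lborel. c\<^sup>2 * (cmod (g x))\<^sup>2)"
    using assms integrable_Re[OF i] by (subst Bochner_Integration.integral_add Bochner_Integration.integral_diff, auto simp: L2_def simp del: times_complex.simps)+
  also have "\<dots> = sqint f - 2 * c * (LINT x|lborel. Re (f x * cnj (g x))) + c\<^sup>2 * sqint g"
    unfolding sqint_def by (simp del: times_complex.simps)
  also have "(LINT x|lborel. Re (f x * cnj (g x))) = Re (LINT x|lborel. f x * cnj (g x))"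
    using i by (rule integral_Re)
  finally show ?thesis .
qed

section \<open>The distance to the spectrum of a symmetric operator\<close>

lemma resolvent_set_lower_bound:
  assumes "z \<in> resolvent_set T"
  obtains K where "K > 0" "\<And>u f. (u, f) \<in> T \<Longrightarrow> sqint u \<le> K * sqint (\<lambda>x. f x - z * u x)"
proof -
  from assms obtain C where C: "\<forall>(u, f)\<in>T. L2_norm u \<le> C * L2_norm (\<lambda>x. f x - z * u x)"
    unfolding resolvent_set_def by blast
  have "sqint u \<le> (C\<^sup>2 + 1) * sqint (\<lambda>x. f x - z * u x)" if "(u, f) \<in> T" for u f
  proof -
    have "L2_norm u \<le> C * L2_norm (\<lambda>x. f x - z * u x)" using C that by blast
    moreover have "0 \<le> L2_norm u" unfolding L2_norm_def by simp
    ultimately have "(L2_norm u)\<^sup>2 \<le> (C * L2_norm (\<lambda>x. f x - z * u x))\<^sup>2" by (simp add: power_mono)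
    then have "sqint u \<le> C\<^sup>2 * sqint (\<lambda>x. f x - z * u x)" by (simp add: power_mult_distrib L2_norm_sq)
    also have "\<dots> \<le> (C\<^sup>2 + 1) * sqint (\<lambda>x. f x - z * u x)"
      by (intro mult_right_mono) (auto simp: sqint_nonneg)
    finally show ?thesis .
  qed
  moreover have "C\<^sup>2 + 1 > 0" by (smt (verit) zero_le_power2)
  ultimately show ?thesis using that by blast
qed

text \<open>
  Let \<open>\<mu> = m\<^sup>2\<close> be the infimum of \<open>\<parallel>(T - E) u\<parallel>\<^sup>2 / \<parallel>u\<parallel>\<^sup>2\<close>, and suppose \<open>m < \<delta>\<close>. For a
  near-minimiser \<open>u\<close> and \<open>w = (T - E)\<^sup>-\<^sup>1 u\<close>, symmetry gives \<open>\<langle>(T - E) u, w\<rangle> = \<parallel>u\<parallel>\<^sup>2\<close>, so that expanding the square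
  shows that \<open>(T - E - m) (T - E + m) w = (T - E) u - \<mu> w\<close> is small. Both factors are bounded below, because
  \<open>E + m\<close> and \<open>E - m\<close> are resolvent points, so \<open>w\<close> is small as well; hence so is \<open>(T - E) u\<close>, contrary to
  \<open>\<mu> > 0\<close>. This is the usual proof that the norm of a bounded self-adjoint operator is attained on its
  spectrum, carried out for the resolvent without reference to a completed Hilbert space.
\<close>

lemma symmetric_gap_lower_bound:
  fixes T :: "(cfun \<times> cfun) set" and E \<delta> :: real
  assumes L2: "\<And>u f. (u, f) \<in> T \<Longrightarrow> u \<in> L2 \<and> f \<in> L2"
    and lin: "\<And>u f w g c. (u, f) \<in> T \<Longrightarrow> (w, g) \<in> T \<Longrightarrow>
           ((\<lambda>x. u x + complex_of_real c * w x), (\<lambda>x. f x + complex_of_real c * g x)) \<in> T"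
    and sym: "\<And>u f w g. (u, f) \<in> T \<Longrightarrow> (w, g) \<in> T \<Longrightarrow>
           (LINT x|lborel. f x * cnj (w x)) = (LINT x|lborel. u x * cnj (g x))"
    and res: "\<And>z. E - \<delta> < z \<Longrightarrow> z < E + \<delta> \<Longrightarrow> complex_of_real z \<in> resolvent_set T"
    and \<delta>: "\<delta> > 0" and uf: "(u, f) \<in> T"
  shows "\<delta>\<^sup>2 * sqint u \<le> sqint (\<lambda>x. f x - complex_of_real E * u x)"
proof -
  define q where "q u f = sqint (\<lambda>x. f x - complex_of_real E * u x)" for u f :: cfun
  define A where "A = {q u f / sqint u |u f. (u, f) \<in> T \<and> sqint u > 0}"
  define \<mu> where "\<mu> = Inf A"
  obtain K0 where K0: "K0 > 0" "\<And>u f. (u, f) \<in> T \<Longrightarrow> sqint u \<le> K0 * q u f"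
    using resolvent_set_lower_bound[OF res[of E]] \<delta> unfolding q_def by auto
  have bdd: "bdd_below A"
    unfolding A_def by (rule bdd_belowI[of _ 0]) (auto simp: q_def sqint_nonneg divide_nonneg_pos)
  have \<mu>_le: "\<mu> * sqint u \<le> q u f" if "(u, f) \<in> T" for u f
  proof (cases "sqint u > 0")
    case True
    then have "q u f / sqint u \<in> A" unfolding A_def using that by blast
    then have "\<mu> \<le> q u f / sqint u" unfolding \<mu>_def using bdd by (rule cInf_lower)
    then show ?thesis using True by (simp add: pos_le_divide_eq)
  next
    case False
    then have "sqint u = 0" using sqint_nonneg[of u] by linarith
    then show ?thesis by (simp add: q_def sqint_nonneg)
  qed
  have "\<delta>\<^sup>2 \<le> \<mu>" if ne: "A \<noteq> {}"
  proof (rule ccontr)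
    assume "\<not> \<delta>\<^sup>2 \<le> \<mu>"
    then have \<mu>\<delta>: "\<mu> < \<delta>\<^sup>2" by simp
    have "1 / K0 \<le> \<mu>"
      unfolding \<mu>_def
    proof (rule cInf_greatest[OF ne])
      fix a assume "a \<in> A"
      then obtain u f where uf: "(u, f) \<in> T" "sqint u > 0" "a = q u f / sqint u" unfolding A_def by blast
      have "1 / K0 * sqint u \<le> q u f" using K0(2)[OF uf(1)] K0(1) by (simp add: field_simps)
      then show "1 / K0 \<le> a" unfolding uf(3) pos_le_divide_eq[OF uf(2)] .
    qed
    moreover have "1 / K0 > 0" using K0(1) by simp
    ultimately have \<mu>0: "\<mu> > 0" by linarith
    define m where "m = sqrt \<mu>"
    have m0: "m > 0" and m2: "m\<^sup>2 = \<mu>" unfolding m_def using \<mu>0 by simp_all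
    have m\<delta>: "m < \<delta>" using \<mu>\<delta> \<delta> m2 m0 by (metis less_eq_real_def not_less power_mono)
    obtain K1 where K1: "K1 > 0" "\<And>u f. (u, f) \<in> T \<Longrightarrow> sqint u \<le> K1 * sqint (\<lambda>x. f x - complex_of_real (E + m) * u x)"
      using resolvent_set_lower_bound[OF res[of "E + m"]] m\<delta> m0 by auto
    obtain K2 where K2: "K2 > 0" "\<And>u f. (u, f) \<in> T \<Longrightarrow> sqint u \<le> K2 * sqint (\<lambda>x. f x - complex_of_real (E - m) * u x)"
      using resolvent_set_lower_bound[OF res[of "E - m"]] m\<delta> m0 by auto
    \<comment> \<open>\<open>c \<eta> \<parallel>u\<parallel>\<^sup>2\<close> will bound \<open>\<parallel>(T - E) u\<parallel>\<^sup>2\<close>, so \<open>\<eta>\<close> is chosen with \<open>c \<eta> = \<mu> / 2\<close>.\<close>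
    define c where "c = 2 * \<mu>\<^sup>2 * (K1 * K2) + 2"
    have c0: "c > 0" unfolding c_def using K1(1) K2(1) \<mu>0 by (smt (verit) mult_pos_pos zero_less_power)
    define \<eta> where "\<eta> = \<mu> / (2 * c)"
    have \<eta>0: "\<eta> > 0" unfolding \<eta>_def using \<mu>0 c0 by simp
    have "Inf A < \<mu> + \<eta>" unfolding \<mu>_def[symmetric] using \<eta>0 by simp
    then obtain a where "a \<in> A" "a < \<mu> + \<eta>" using cInf_lessD[OF ne] by blast
    then obtain u f where uf: "(u, f) \<in> T" and u0: "sqint u > 0" and "q u f / sqint u < \<mu> + \<eta>"
      unfolding A_def by blast
    then have near: "q u f \<le> (\<mu> + \<eta>) * sqint u" by (simp add: pos_divide_less_eq)
    define h where "h = (\<lambda>x. f x - complex_of_real E * u x)"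
    have uL: "u \<in> L2" and fL: "f \<in> L2" using L2[OF uf] by auto
    have hL: "h \<in> L2" unfolding h_def by (intro L2_diff L2_cmult uL fL)
    have "complex_of_real E \<in> resolvent_set T" using res[of E] \<delta> by simp
    then obtain w g where wg: "(w, g) \<in> T" and weq: "AE x in lborel. g x - complex_of_real E * w x = u x"
      unfolding resolvent_set_def using uL by blast
    have wL: "w \<in> L2" and gL: "g \<in> L2" using L2[OF wg] by auto
    define k where "k = (\<lambda>x. g x - complex_of_real E * w x)"
    have kL: "k \<in> L2" unfolding k_def by (intro L2_diff L2_cmult wL gL)
    have ku: "AE x in lborel. k x = u x" using weq by (simp add: k_def)
    have Nk: "sqint k = sqint u" by (rule sqint_cong_AE[OF kL uL ku])
    have w_le: "\<mu> * sqint w \<le> sqint u" using \<mu>_le[OF wg] Nk by (simp add: q_def k_def)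
    have hw: "(LINT x|lborel. h x * cnj (w x)) = (LINT x|lborel. u x * cnj (k x))"
    proof -
      have "(LINT x|lborel. h x * cnj (w x))
        = (LINT x|lborel. f x * cnj (w x) - complex_of_real E * (u x * cnj (w x)))"
        by (simp add: h_def algebra_simps)
      also have "\<dots> = (LINT x|lborel. f x * cnj (w x)) - (LINT x|lborel. complex_of_real E * (u x * cnj (w x)))"
        using L2_mult_integrable[OF fL L2_cnj[OF wL]] L2_mult_integrable[OF uL L2_cnj[OF wL]] by simp
      also have "\<dots> = (LINT x|lborel. u x * cnj (g x)) - (LINT x|lborel. complex_of_real E * (u x * cnj (w x)))"
        using sym[OF uf wg] by simp
      also have "\<dots> = (LINT x|lborel. u x * cnj (g x) - complex_of_real E * (u x * cnj (w x)))"
        using L2_mult_integrable[OF uL L2_cnj[OF gL]] L2_mult_integrable[OF uL L2_cnj[OF wL]] by simp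
      also have "\<dots> = (LINT x|lborel. u x * cnj (k x))"
        by (simp add: k_def algebra_simps)
      finally show ?thesis .
    qed
    have "(LINT x|lborel. u x * cnj (k x)) = (LINT x|lborel. u x * cnj (u x))"
    proof (rule integral_cong_AE)
      show "(\<lambda>x. u x * cnj (k x)) \<in> borel_measurable lborel" "(\<lambda>x. u x * cnj (u x)) \<in> borel_measurable lborel"
        using L2_mult_integrable[OF uL L2_cnj[OF kL]] L2_mult_integrable[OF uL L2_cnj[OF uL]]
        by (auto intro: borel_measurable_integrable)
      show "AE x in lborel. u x * cnj (k x) = u x * cnj (u x)" using ku by eventually_elim simp
    qed
    also have "\<dots> = complex_of_real (sqint u)"
      unfolding sqint_def integral_complex_of_real[symmetric] by (simp only: complex_norm_square)
    finally have inner: "Re (LINT x|lborel. h x * cnj (w x)) = sqint u" using hw by simp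
    define r where "r = (\<lambda>x. h x - complex_of_real \<mu> * w x)"
    have rL: "r \<in> L2" unfolding r_def by (intro L2_diff L2_cmult hL wL)
    have "sqint r = sqint h - 2 * \<mu> * sqint u + \<mu>\<^sup>2 * sqint w"
      unfolding r_def sqint_diff[OF hL wL] inner by simp
    also have "\<dots> \<le> sqint h - 2 * \<mu> * sqint u + \<mu> * sqint u"
      using mult_left_mono[OF w_le, of \<mu>] \<mu>0 by (simp add: power2_eq_square)
    also have "\<dots> \<le> \<eta> * sqint u"
      using near by (simp add: q_def h_def algebra_simps)
    finally have r_le: "sqint r \<le> \<eta> * sqint u" .
    \<comment> \<open>\<open>r = (T - E - m)(T - E + m) w\<close>; both factors are bounded below.\<close>
    define v where "v = (\<lambda>x. u x + complex_of_real m * w x)"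
    define l where "l = (\<lambda>x. f x + complex_of_real m * g x)"
    have vl: "(v, l) \<in> T" unfolding v_def l_def by (rule lin[OF uf wg])
    have vL: "v \<in> L2" and lL: "l \<in> L2" using L2[OF vl] by auto
    have "sqint (\<lambda>x. l x - complex_of_real (E + m) * v x) = sqint r"
    proof (rule sqint_cong_AE)
      show "(\<lambda>x. l x - complex_of_real (E + m) * v x) \<in> L2" by (intro L2_diff L2_cmult vL lL)
      have mm: "complex_of_real m * complex_of_real m = complex_of_real \<mu>"
        using m2 by (metis of_real_mult power2_eq_square)
      show "AE x in lborel. l x - complex_of_real (E + m) * v x = r x"
        using weq
      proof eventually_elim
        case (elim x)
        have "l x - complex_of_real (E + m) * v x
          = h x + complex_of_real m * (g x - complex_of_real E * w x - u x) - (complex_of_real m * complex_of_real m) * w x"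
          by (simp add: l_def v_def h_def algebra_simps)
        then show ?case using elim mm by (simp add: r_def)
      qed
    qed (rule rL)
    then have v_le: "sqint v \<le> K1 * sqint r" using K1(2)[OF vl] by simp
    have "sqint (\<lambda>x. g x - complex_of_real (E - m) * w x) = sqint v"
    proof (rule sqint_cong_AE)
      show "(\<lambda>x. g x - complex_of_real (E - m) * w x) \<in> L2" by (intro L2_diff L2_cmult wL gL)
      show "AE x in lborel. g x - complex_of_real (E - m) * w x = v x"
        using weq by eventually_elim (simp add: v_def algebra_simps)
    qed (rule vL)
    then have "sqint w \<le> K2 * sqint v" using K2(2)[OF wg] by simp
    also have "\<dots> \<le> K2 * (K1 * (\<eta> * sqint u))"
      using order_trans[OF v_le mult_left_mono[OF r_le, of K1]] K1(1) K2(1) by (intro mult_left_mono) auto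
    finally have w_small: "sqint w \<le> K1 * K2 * \<eta> * sqint u" by (simp add: mult_ac)
    have "\<mu> * sqint u \<le> sqint h" using \<mu>_le[OF uf] by (simp add: q_def h_def)
    also have "sqint h = sqint (\<lambda>x. r x + complex_of_real \<mu> * w x)" by (simp add: r_def)
    also have "\<dots> \<le> 2 * sqint r + 2 * sqint (\<lambda>x. complex_of_real \<mu> * w x)"
      by (rule sqint_add_le[OF rL L2_cmult[OF wL]])
    also have "\<dots> \<le> 2 * (\<eta> * sqint u) + 2 * (\<mu>\<^sup>2 * (K1 * K2 * \<eta> * sqint u))"
      using r_le mult_left_mono[OF w_small, of "\<mu>\<^sup>2"] by (simp add: sqint_cmult)
    also have "\<dots> = c * \<eta> * sqint u" by (simp add: c_def algebra_simps)
    also have "\<dots> = \<mu> / 2 * sqint u" using c0 by (simp add: \<eta>_def)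
    finally show False using \<mu>0 u0 by (simp add: field_simps)
  qed
  show ?thesis
  proof (cases "sqint u > 0")
    case True
    then have "A \<noteq> {}" unfolding A_def using uf by blast
    then have "\<delta>\<^sup>2 \<le> \<mu>" by fact
    then have "\<delta>\<^sup>2 * sqint u \<le> \<mu> * sqint u" by (simp add: mult_right_mono sqint_nonneg)
    also have "\<dots> \<le> q u f" by (rule \<mu>_le[OF uf])
    finally show ?thesis by (simp add: q_def)
  next
    case False
    then have "sqint u = 0" using sqint_nonneg[of u] by linarith
    then show ?thesis by (simp add: sqint_nonneg)
  qed
qed

section \<open>Smooth functions and test functions\<close>

text \<open>
  The recursion peels off the innermost derivative, so that closure under products, inverses and
  substitutions follows by induction on the order from the corresponding rule for one derivative.
\<close>

primrec differentiable_upto :: "nat \<Rightarrow> cfun \<Rightarrow> bool" where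
  "differentiable_upto 0 f \<longleftrightarrow> f differentiable_on UNIV"
| "differentiable_upto (Suc n) f \<longleftrightarrow> f differentiable_on UNIV \<and> differentiable_upto n (vderiv f)"

lemma differentiable_upto_iff: "differentiable_upto n f \<longleftrightarrow> (\<forall>k\<le>n. (vderiv ^^ k) f differentiable_on UNIV)"
proof (induction n arbitrary: f)
  case (Suc n)
  have "(\<forall>k\<le>Suc n. (vderiv ^^ k) f differentiable_on UNIV) \<longleftrightarrow>
     f differentiable_on UNIV \<and> (\<forall>k\<le>n. (vderiv ^^ Suc k) f differentiable_on UNIV)" (is "?l \<longleftrightarrow> ?r")
  proof
    assume ?l then show ?r by (auto dest: spec[of _ 0] simp del: funpow.simps(2))
  next
    assume r: ?r show ?l
    proof (intro allI impI)
      fix k assume "k \<le> Suc n" then show "(vderiv ^^ k) f differentiable_on UNIV"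
        using r by (cases k) (auto simp del: funpow.simps(2))
    qed
  qed
  then show ?case using Suc by (simp add: funpow_Suc_right del: funpow.simps(2))
qed simp

lemma smooth_iff_upto: "smooth f \<longleftrightarrow> (\<forall>n. differentiable_upto n f)"
  unfolding smooth_def differentiable_upto_iff by blast

lemma differentiable_upto_differentiable: "differentiable_upto n f \<Longrightarrow> f differentiable_on UNIV"
  by (cases n) auto

lemma differentiable_upto_Suc_imp: "differentiable_upto (Suc n) f \<Longrightarrow> differentiable_upto n f"
  by (induction n arbitrary: f) auto

lemma has_vderiv: "f differentiable_on UNIV \<Longrightarrow> (f has_vector_derivative vderiv f x) (at x)"
  unfolding vderiv_def differentiable_on_def using vector_derivative_works by auto

lemma vderiv_eqI: "(\<And>x. (f has_vector_derivative f' x) (at x)) \<Longrightarrow> vderiv f = f'"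
  unfolding vderiv_def by (auto intro: vector_derivative_at)

lemma differentiable_onI_vd: "(\<And>x. (f has_vector_derivative f' x) (at x)) \<Longrightarrow> f differentiable_on UNIV"
  unfolding differentiable_on_def using differentiableI_vector by blast

lemma differentiable_upto_SucI:
  assumes "\<And>x. (f has_vector_derivative f' x) (at x)" "differentiable_upto n f'"
  shows "differentiable_upto (Suc n) f"
  using assms vderiv_eqI[OF assms(1)] differentiable_onI_vd[OF assms(1)] by simp

lemma smooth_has_vderiv: "smooth f \<Longrightarrow> (f has_vector_derivative vderiv f x) (at x)"
  by (rule has_vderiv) (simp add: smooth_iff_upto differentiable_upto_differentiable)

lemma smooth_continuous: "smooth f \<Longrightarrow> continuous_on A f"
  by (meson continuous_at_imp_continuous_on has_vector_derivative_continuous smooth_has_vderiv)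

lemma smooth_vderiv: "smooth f \<Longrightarrow> smooth (vderiv f)"
  unfolding smooth_iff_upto
proof
  fix n assume "\<forall>n. differentiable_upto n f"
  then have "differentiable_upto (Suc n) f" ..
  then show "differentiable_upto n (vderiv f)" by simp
qed

lemma smooth_antiderivative:
  assumes "\<And>x. (F has_vector_derivative f x) (at x)" "smooth f"
  shows "smooth F"
  unfolding smooth_iff_upto
proof
  fix n show "differentiable_upto n F"
    by (rule differentiable_upto_Suc_imp, rule differentiable_upto_SucI[OF assms(1)])
       (use assms(2) in \<open>simp add: smooth_iff_upto\<close>)
qed

lemma differentiable_upto_const: "differentiable_upto n (\<lambda>_. c)"
proof (induction n arbitrary: c)
  case (Suc n)
  then show ?case by (intro differentiable_upto_SucI[where f'="\<lambda>_. 0"]) auto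
qed simp

lemma differentiable_upto_add:
  "differentiable_upto n f \<Longrightarrow> differentiable_upto n g \<Longrightarrow> differentiable_upto n (\<lambda>x. f x + g x)"
proof (induction n arbitrary: f g)
  case (Suc n)
  show ?case
    by (rule differentiable_upto_SucI[where f'="\<lambda>x. vderiv f x + vderiv g x"])
       (use Suc in \<open>auto intro!: has_vector_derivative_add has_vderiv\<close>)
qed (auto intro: differentiable_on_add)

lemma differentiable_upto_mult:
  "differentiable_upto n f \<Longrightarrow> differentiable_upto n g \<Longrightarrow> differentiable_upto n (\<lambda>x. f x * g x)"
proof (induction n arbitrary: f g)
  case (Suc n)
  have "differentiable_upto n f" "differentiable_upto n g"
    using Suc.prems differentiable_upto_Suc_imp by blast+
  show ?case
    by (rule differentiable_upto_SucI[where f'="\<lambda>x. f x * vderiv g x + vderiv f x * g x"])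
       (use Suc \<open>differentiable_upto n f\<close> \<open>differentiable_upto n g\<close> in
         \<open>auto intro!: has_vector_derivative_mult has_vderiv differentiable_upto_add\<close>)
qed (auto intro: differentiable_on_mult)

lemma differentiable_upto_inverse:
  "differentiable_upto n f \<Longrightarrow> (\<And>x. f x \<noteq> 0) \<Longrightarrow> differentiable_upto n (\<lambda>x. inverse (f x))"
proof (induction n)
  case (Suc n)
  have f: "differentiable_upto n f" using Suc.prems differentiable_upto_Suc_imp by blast
  have "((\<lambda>x. inverse (f x)) has_vector_derivative (- 1) * (vderiv f x * (inverse (f x) * inverse (f x)))) (at x)" for x
  proof -
    have "(f has_vector_derivative vderiv f x) (at x)" using Suc.prems(1) has_vderiv by simp
    from field_vector_diff_chain_at[OF this DERIV_inverse[OF Suc.prems(2)[of x]]]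
    show ?thesis by (simp add: o_def power2_eq_square)
  qed
  then show ?case
    by (rule differentiable_upto_SucI)
       (intro differentiable_upto_mult differentiable_upto_const Suc.IH f Suc.prems(2), use Suc.prems(1) in simp)
next
  case 0
  then show ?case by (auto simp: differentiable_on_def intro!: differentiable_inverse)
qed

lemma differentiable_upto_affine:
  "differentiable_upto n f \<Longrightarrow> differentiable_upto n (\<lambda>x. f (a * x + b))"
proof -
  have D: "((\<lambda>x. f (a * x + b)) has_vector_derivative complex_of_real a * vderiv f (a * x + b)) (at x)"
    if "f differentiable_on UNIV" for f and x :: real
  proof -
    have "((\<lambda>x. a * x + b) has_vector_derivative a) (at x)"
      by (auto intro!: derivative_eq_intros)
    from vector_diff_chain_at[OF this has_vderiv[OF that]] show ?thesis
      by (simp add: o_def scaleR_conv_of_real)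
  qed
  show "differentiable_upto n f \<Longrightarrow> differentiable_upto n (\<lambda>x. f (a * x + b))"
  proof (induction n arbitrary: f)
    case 0
    then show ?case using differentiable_onI_vd[OF D] by simp
  next
    case (Suc n)
    show ?case
      by (rule differentiable_upto_SucI[OF D])
         (use Suc in \<open>auto intro!: differentiable_upto_mult differentiable_upto_const\<close>)
  qed
qed

lemma smooth_const: "smooth (\<lambda>_. c)"
  by (simp add: smooth_iff_upto differentiable_upto_const)

lemma smooth_add: "smooth f \<Longrightarrow> smooth g \<Longrightarrow> smooth (\<lambda>x. f x + g x)"
  by (simp add: smooth_iff_upto differentiable_upto_add)

lemma smooth_mult: "smooth f \<Longrightarrow> smooth g \<Longrightarrow> smooth (\<lambda>x. f x * g x)"
  by (simp add: smooth_iff_upto differentiable_upto_mult)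

lemma smooth_inverse: "smooth f \<Longrightarrow> (\<And>x. f x \<noteq> 0) \<Longrightarrow> smooth (\<lambda>x. inverse (f x))"
  by (simp add: smooth_iff_upto differentiable_upto_inverse)

lemma smooth_affine: "smooth f \<Longrightarrow> smooth (\<lambda>x. f (a * x + b))"
  by (simp add: smooth_iff_upto differentiable_upto_affine)

lemma smooth_cnj:
  assumes "smooth f" shows "smooth (\<lambda>x. cnj (f x))" "vderiv (\<lambda>x. cnj (f x)) = (\<lambda>x. cnj (vderiv f x))"
proof -
  have D: "((\<lambda>x. cnj (f x)) has_vector_derivative cnj (vderiv f x)) (at x)" if "f differentiable_on UNIV" for f x
    using has_vderiv[OF that] by (rule has_vector_derivative_cnj)
  have "differentiable_upto n f \<Longrightarrow> differentiable_upto n (\<lambda>x. cnj (f x))" for n f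
  proof (induction n arbitrary: f)
    case 0
    then show ?case using differentiable_onI_vd[OF D] by simp
  next
    case (Suc n)
    show ?case by (rule differentiable_upto_SucI[OF D]) (use Suc in auto)
  qed
  then show "smooth (\<lambda>x. cnj (f x))" using assms unfolding smooth_iff_upto by blast
  show "vderiv (\<lambda>x. cnj (f x)) = (\<lambda>x. cnj (vderiv f x))"
    by (rule vderiv_eqI, rule D) (use assms in \<open>simp add: smooth_iff_upto differentiable_upto_differentiable\<close>)
qed

text \<open>
  The functions \<open>x\<^sup>-\<^sup>k exp (- 1 / x)\<close> for \<open>x > 0\<close>, extended by zero: differentiation stays within their linear
  span, which makes the smoothness of \<open>exp (- 1 / x)\<close> at the origin an easy induction.
\<close>

definition flat :: "nat \<Rightarrow> cfun" where
  "flat k x = complex_of_real (if x > 0 then inverse x ^ k * exp (- inverse x) else 0)"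

lemma flat_tendsto_0: "((\<lambda>x. inverse x ^ k * exp (- inverse x)) \<longlongrightarrow> (0::real)) (at_right 0)"
proof -
  have "((\<lambda>y. y ^ k / exp y) \<longlongrightarrow> (0::real)) at_top" by (rule tendsto_power_div_exp_0)
  from filterlim_compose[OF this filterlim_inverse_at_top_right]
  show ?thesis by (simp add: exp_minus divide_inverse)
qed

lemma flat_deriv: "(flat k has_vector_derivative - of_nat k * flat (Suc k) x + flat (Suc (Suc k)) x) (at x)"
proof -
  define e :: "nat \<Rightarrow> real \<Rightarrow> real" where "e k x = (if x > 0 then inverse x ^ k * exp (- inverse x) else 0)" for k x
  have "(e k has_real_derivative - real k * e (Suc k) x + e (Suc (Suc k)) x) (at x)"
  proof -
    consider "x > 0" | "x < 0" | "x = 0" by linarith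
    then show ?thesis
    proof cases
      case 1
      have D: "((\<lambda>x. inverse x ^ k * exp (- inverse x)) has_real_derivative - real k * e (Suc k) x + e (Suc (Suc k)) x) (at x)"
      proof -
        have d: "((\<lambda>x. inverse x) has_real_derivative - (inverse x * inverse x)) (at x)"
          using 1 DERIV_inverse[of x] by (simp add: power2_eq_square)
        have "((\<lambda>x. inverse x ^ k * exp (- inverse x)) has_real_derivative
            (real k * (- (inverse x * inverse x) * inverse x ^ (k - Suc 0))) * exp (- inverse x)
            + exp (- inverse x) * - (- (inverse x * inverse x)) * inverse x ^ k) (at x)"
          by (intro DERIV_mult DERIV_fun_exp[OF DERIV_minus[OF d]]) (use DERIV_power[OF d, of k] in simp)
        moreover have "(real k * (- (y * y) * y ^ (k - Suc 0))) * exp (- y) + exp (- y) * - (- (y * y)) * y ^ k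
           = - real k * (y ^ Suc k * exp (- y)) + y ^ Suc (Suc k) * exp (- y)" for y :: real
          by (cases k) (simp_all add: algebra_simps)
        ultimately show ?thesis using 1 by (simp only: e_def if_True)
      qed
      have "\<forall>\<^sub>F y in nhds x. y \<in> {0<..}" using 1 by (intro eventually_nhds_in_open) auto
      then have "\<forall>\<^sub>F y in nhds x. e k y = inverse y ^ k * exp (- inverse y)"
        by eventually_elim (simp add: e_def)
      then show ?thesis using D by (subst DERIV_cong_ev[OF refl _ refl]) auto
    next
      case 2
      have "\<forall>\<^sub>F y in nhds x. y \<in> {..<0}" using 2 by (intro eventually_nhds_in_open) auto
      then have "\<forall>\<^sub>F y in nhds x. e k y = 0"
        by eventually_elim (simp add: e_def)
      then show ?thesis using 2 by (subst DERIV_cong_ev[OF refl _ refl]) (auto simp: e_def)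
    next
      case 3
      have "((\<lambda>h. (e k (0 + h) - e k 0) / h) \<longlongrightarrow> 0) (at 0)"
        unfolding filterlim_at_split
      proof
        show "((\<lambda>h. (e k (0 + h) - e k 0) / h) \<longlongrightarrow> 0) (at_left 0)"
          by (rule tendsto_eventually) (auto simp: e_def eventually_at_filter)
        have "inverse h ^ Suc k * exp (- inverse h) = (e k (0 + h) - e k 0) / h" if "h > 0" for h
          using that by (simp add: e_def divide_inverse mult_ac)
        then have "\<forall>\<^sub>F h in at_right 0. inverse h ^ Suc k * exp (- inverse h) = (e k (0 + h) - e k 0) / h"
          by (simp add: eventually_at_filter)
        then show "((\<lambda>h. (e k (0 + h) - e k 0) / h) \<longlongrightarrow> 0) (at_right 0)"
          using flat_tendsto_0[of "Suc k"] by (rule Lim_transform_eventually[rotated])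
      qed
      then have "(e k has_real_derivative 0) (at 0)" by (simp add: DERIV_def)
      then show ?thesis using 3 by (simp add: e_def)
    qed
  qed
  then have "((\<lambda>x. complex_of_real (e k x)) has_vector_derivative complex_of_real (- real k * e (Suc k) x + e (Suc (Suc k)) x)) (at x)"
    unfolding has_real_derivative_iff_has_vector_derivative
    by (rule bounded_linear.has_vector_derivative[OF bounded_linear_of_real])
  moreover have "flat k = (\<lambda>x. complex_of_real (e k x))" for k by (auto simp: flat_def e_def fun_eq_iff)
  ultimately show ?thesis by simp
qed

lemma smooth_flat: "smooth (flat k)"
proof -
  have "differentiable_upto n (flat k)" for n
  proof (induction n arbitrary: k)
    case 0
    show ?case using differentiable_onI_vd[OF flat_deriv] by simp
  next
    case (Suc n)
    show ?case by (rule differentiable_upto_SucI[OF flat_deriv])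
       (intro differentiable_upto_add differentiable_upto_mult differentiable_upto_const Suc)
  qed
  then show ?thesis by (simp add: smooth_iff_upto)
qed

definition ramp :: "real \<Rightarrow> real" where
  "ramp x = (if x > 0 then exp (- inverse x) else 0)"

lemma smooth_ramp: "smooth (\<lambda>x. complex_of_real (ramp x))"
proof -
  have "(\<lambda>x. complex_of_real (ramp x)) = flat 0" by (auto simp: ramp_def flat_def fun_eq_iff)
  then show ?thesis using smooth_flat by simp
qed

lemma ramp_bounds: "0 \<le> ramp x" "ramp x \<le> 1" "x \<le> 0 \<Longrightarrow> ramp x = 0" "x > 0 \<Longrightarrow> ramp x > 0"
  by (auto simp: ramp_def)

lemma test_funI:
  assumes "smooth f" "\<And>x. \<bar>x\<bar> > L \<Longrightarrow> f x = 0"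
  shows "test_fun f"
proof -
  have "{x. f x \<noteq> 0} \<subseteq> {-L..L}"
  proof
    fix x assume "x \<in> {x. f x \<noteq> 0}"
    then have "\<not> \<bar>x\<bar> > L" using assms(2) by blast
    then show "x \<in> {-L..L}" unfolding atLeastAtMost_iff by linarith
  qed
  then have "closure {x. f x \<noteq> 0} \<subseteq> {-L..L}" by (rule closure_minimal) simp
  then have "compact (closure {x. f x \<noteq> 0})"
    using bounded_subset[OF bounded_closed_interval] by (simp add: compact_eq_bounded_closed)
  then show ?thesis using assms(1) by (simp add: test_fun_def)
qed

lemma test_funE:
  assumes "test_fun f"
  obtains L where "L > 0" "\<And>x. \<bar>x\<bar> > L \<Longrightarrow> f x = 0" "\<And>x. \<bar>x\<bar> > L \<Longrightarrow> vderiv f x = 0"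
proof -
  from assms have "bounded (closure {x. f x \<noteq> 0})" by (simp add: test_fun_def compact_eq_bounded_closed)
  then obtain L where L: "L > 0" "\<forall>x \<in> closure {x. f x \<noteq> 0}. norm x \<le> L"
    unfolding bounded_pos by (elim exE conjE)
  have z: "f x = 0" if "\<bar>x\<bar> > L" for x
  proof (rule ccontr)
    assume "f x \<noteq> 0"
    then have "x \<in> closure {x. f x \<noteq> 0}" using closure_subset[of "{x. f x \<noteq> 0}"] by blast
    then have "norm x \<le> L" using L(2) by blast
    then show False using that by simp
  qed
  have "vderiv f x = 0" if "\<bar>x\<bar> > L" for x
  proof -
    have "open {x::real. \<bar>x\<bar> > L}" by (intro open_Collect_less continuous_intros)
    then have "(f has_vector_derivative 0) (at x)"
      by (rule has_vector_derivative_transform_within_open[OF has_vector_derivative_const]) (use that z in simp_all)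
    then show ?thesis unfolding vderiv_def by (rule vector_derivative_at)
  qed
  with L(1) z show ?thesis by (rule that)
qed

lemma test_fun_smooth: "test_fun f \<Longrightarrow> smooth f" by (simp add: test_fun_def)

lemma test_fun_mult: assumes "smooth a" "test_fun f" shows "test_fun (\<lambda>x. a x * f x)"
proof -
  obtain L where L: "\<And>x. \<bar>x\<bar> > L \<Longrightarrow> f x = 0" using test_funE[OF assms(2)] by metis
  show ?thesis by (rule test_funI[where L=L]) (simp_all add: L smooth_mult assms test_fun_smooth)
qed

lemma test_fun_vderiv: assumes "test_fun f" shows "test_fun (vderiv f)"
proof -
  obtain L where L: "\<And>x. \<bar>x\<bar> > L \<Longrightarrow> vderiv f x = 0" using test_funE[OF assms] by metis
  show ?thesis by (rule test_funI[where L=L]) (simp_all add: L smooth_vderiv assms test_fun_smooth)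
qed

text \<open>
  Each factor is a smooth step of the form \<open>e(2 - y) / (e(2 - y) + e(y - 1))\<close> with \<open>e\<close> the flat ramp: it is 1 for
  \<open>y \<le> 1\<close> and 0 for \<open>y \<ge> 2\<close>. One factor has \<open>y = x\<close>, the other \<open>y = - x\<close>.
\<close>

definition cutoff :: cfun where
  "cutoff x = complex_of_real (ramp (2 - x) * inverse (ramp (2 - x) + ramp (x - 1)) *
                 (ramp (2 + x) * inverse (ramp (2 + x) + ramp (- x - 1))))"

lemma cutoff_smooth: "smooth cutoff"
  and cutoff_eq_1: "\<bar>x\<bar> \<le> 1 \<Longrightarrow> cutoff x = 1"
  and cutoff_eq_0: "\<bar>x\<bar> \<ge> 2 \<Longrightarrow> cutoff x = 0"
  and cutoff_le_1: "cmod (cutoff x) \<le> 1"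
proof -
  have pos: "ramp (2 - x) + ramp (x - 1) > 0" "ramp (2 + x) + ramp (- x - 1) > 0" for x
  proof -
    have p: "a > 0 \<or> b > 0 \<Longrightarrow> ramp a + ramp b > 0" for a b
      using ramp_bounds(1)[of a] ramp_bounds(1)[of b] ramp_bounds(4)[of a] ramp_bounds(4)[of b] by auto
    show "ramp (2 - x) + ramp (x - 1) > 0" by (rule p) linarith
    show "ramp (2 + x) + ramp (- x - 1) > 0" by (rule p) linarith
  qed
  have sm: "smooth (\<lambda>x. complex_of_real (ramp (a * x + b)))" for a b
    by (rule smooth_affine[OF smooth_ramp])
  have "complex_of_real (ramp (2 - x)) + complex_of_real (ramp (x - 1)) \<noteq> 0"
       "complex_of_real (ramp (2 + x)) + complex_of_real (ramp (- x - 1)) \<noteq> 0" for x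
    using pos[of x] unfolding of_real_add[symmetric] of_real_eq_0_iff by simp_all
  then have "smooth (\<lambda>x. complex_of_real (ramp (2 - x)) * inverse (complex_of_real (ramp (2 - x)) + complex_of_real (ramp (x - 1))) *
     (complex_of_real (ramp (2 + x)) * inverse (complex_of_real (ramp (2 + x)) + complex_of_real (ramp (- x - 1)))))"
    using sm[of "-1" 2] sm[of 1 "-1"] sm[of 1 2] sm[of "-1" "-1"]
    by (intro smooth_mult smooth_inverse smooth_add) (simp_all add: add.commute)
  then show "smooth cutoff" by (simp add: cutoff_def[abs_def])
  show "cutoff x = 1" if "\<bar>x\<bar> \<le> 1"
  proof -
    have "ramp (x - 1) = 0" by (rule ramp_bounds(3)) (use that in linarith)
    moreover have "ramp (- x - 1) = 0" by (rule ramp_bounds(3)) (use that in linarith)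
    ultimately show ?thesis using pos[of x] by (simp add: cutoff_def)
  qed
  show "cutoff x = 0" if "\<bar>x\<bar> \<ge> 2"
  proof -
    have "2 - x \<le> 0 \<or> 2 + x \<le> 0" using that by linarith
    then have "ramp (2 - x) = 0 \<or> ramp (2 + x) = 0" using ramp_bounds(3) by blast
    then show ?thesis by (auto simp: cutoff_def)
  qed
  have le: "0 \<le> a \<Longrightarrow> 0 \<le> b \<Longrightarrow> a + b > 0 \<Longrightarrow> \<bar>a * inverse (a + b)\<bar> \<le> 1" for a b :: real
    by (simp add: abs_mult flip: divide_inverse)
  have "\<bar>ramp (2 - x) * inverse (ramp (2 - x) + ramp (x - 1))\<bar> \<le> 1"
       "\<bar>ramp (2 + x) * inverse (ramp (2 + x) + ramp (- x - 1))\<bar> \<le> 1"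
    by (rule le[OF ramp_bounds(1) ramp_bounds(1) pos(1)], rule le[OF ramp_bounds(1) ramp_bounds(1) pos(2)])
  then show "cmod (cutoff x) \<le> 1"
    unfolding cutoff_def norm_of_real by (subst abs_mult) (rule mult_le_one, auto)
qed

section \<open>Locally integrable functions and weak derivatives\<close>

lemma continuous_locally_integrable:
  "continuous_on UNIV f \<Longrightarrow> locally_integrable f"
  unfolding locally_integrable_def set_integrable_def
  by (auto intro: borel_integrable_compact continuous_on_subset)

lemma locally_integrable_mult_continuous:
  assumes "locally_integrable u" "continuous_on UNIV a"
  shows "locally_integrable (\<lambda>x. a x * u x)"
  unfolding locally_integrable_def set_integrable_def
proof (intro allI impI)
  fix K :: "real set" assume K: "compact K"
  then have [measurable]: "K \<in> sets borel" by (simp add: borel_compact)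
  have i: "integrable lborel (\<lambda>x. indicator K x *\<^sub>R u x)"
    using assms(1) K unfolding locally_integrable_def set_integrable_def by blast
  have [measurable]: "a \<in> borel_measurable borel"
    using assms(2) by (rule borel_measurable_continuous_onI)
  have "bounded (a ` K)"
    using K assms(2) by (intro compact_imp_bounded compact_continuous_image) (auto intro: continuous_on_subset)
  then obtain B where B: "\<forall>x\<in>K. cmod (a x) \<le> B" unfolding bounded_iff by auto
  show "integrable lborel (\<lambda>x. indicator K x *\<^sub>R (a x * u x))"
  proof (rule Bochner_Integration.integrable_bound)
    show "integrable lborel (\<lambda>x. B * norm (indicator K x *\<^sub>R u x))"
      by (intro integrable_mult_right integrable_norm i)
    have "(\<lambda>x. a x * (indicator K x *\<^sub>R u x)) \<in> borel_measurable lborel"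
      using borel_measurable_integrable[OF i] by measurable
    then show "(\<lambda>x. indicator K x *\<^sub>R (a x * u x)) \<in> borel_measurable lborel" by simp
    show "AE x in lborel. norm (indicator K x *\<^sub>R (a x * u x)) \<le> norm (B * norm (indicator K x *\<^sub>R u x))"
    proof (rule AE_I2)
      fix x
      show "norm (indicator K x *\<^sub>R (a x * u x)) \<le> norm (B * norm (indicator K x *\<^sub>R u x))"
      proof (cases "x \<in> K")
        case True
        then have "cmod (a x) \<le> B" using B by blast
        then have "cmod (a x) \<le> \<bar>B\<bar>" by linarith
        then show ?thesis using True by (simp add: norm_mult abs_mult mult_right_mono)
      qed simp
    qed
  qed
qed

lemma locally_integrable_add:
  "locally_integrable u \<Longrightarrow> locally_integrable v \<Longrightarrow> locally_integrable (\<lambda>x. u x + v x)"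
  unfolding locally_integrable_def by (auto intro: set_integral_add)

lemma locally_integrable_cnj:
  "locally_integrable u \<Longrightarrow> locally_integrable (\<lambda>x. cnj (u x))"
  unfolding locally_integrable_def set_integrable_def
proof (intro allI impI)
  fix K :: "real set"
  assume "\<forall>K. compact K \<longrightarrow> integrable lborel (\<lambda>x. indicator K x *\<^sub>R u x)" "compact K"
  then have "integrable lborel (\<lambda>x. cnj (indicator K x *\<^sub>R u x))"
    by (intro integrable_cnj) blast
  then show "integrable lborel (\<lambda>x. indicator K x *\<^sub>R cnj (u x))" by simp
qed

lemma locally_integrable_compact_support:
  assumes "locally_integrable u" "\<And>x. \<bar>x\<bar> > L \<Longrightarrow> u x = 0"
  shows "integrable lborel u"
proof -
  have "u = (\<lambda>x. indicator {-L..L} x *\<^sub>R u x)"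
  proof
    fix x show "u x = indicator {-L..L} x *\<^sub>R u x"
      using assms(2)[of x] by (cases "\<bar>x\<bar> > L") (auto simp: indicator_def abs_le_iff)
  qed
  moreover have "integrable lborel (\<lambda>x. indicator {-L..L} x *\<^sub>R u x)"
    using assms(1) unfolding locally_integrable_def set_integrable_def by blast
  ultimately show ?thesis by simp
qed

lemma locally_integrable_test_integrable:
  assumes "locally_integrable u" "test_fun \<phi>"
  shows "integrable lborel (\<lambda>x. u x * \<phi> x)"
proof -
  obtain L where L: "\<And>x. \<bar>x\<bar> > L \<Longrightarrow> \<phi> x = 0" using test_funE[OF assms(2)] by metis
  have "locally_integrable (\<lambda>x. \<phi> x * u x)"
    by (intro locally_integrable_mult_continuous assms smooth_continuous test_fun_smooth)
  then have "integrable lborel (\<lambda>x. \<phi> x * u x)"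
    by (rule locally_integrable_compact_support[where L=L]) (simp add: L)
  then show ?thesis by (simp add: mult.commute)
qed

lemma test_fun_integrable: "test_fun \<phi> \<Longrightarrow> integrable lborel \<phi>"
  using locally_integrable_test_integrable[OF continuous_locally_integrable[OF continuous_on_const], of \<phi> 1] by simp

lemma integral_deriv_compact_support:
  fixes F f :: cfun
  assumes F: "\<And>x. (F has_vector_derivative f x) (at x)" and f: "continuous_on UNIV f"
    and "\<And>x. \<bar>x\<bar> > L \<Longrightarrow> F x = 0" "\<And>x. \<bar>x\<bar> > L \<Longrightarrow> f x = 0"
  shows "(LINT x|lborel. f x) = 0"
proof -
  define M where "M = \<bar>L\<bar> + 1"
  have eq: "f x = indicator {-M..M} x *\<^sub>R f x" for x
  proof (cases "\<bar>x\<bar> > L")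
    case False
    then have "x \<in> {-M..M}" unfolding M_def atLeastAtMost_iff by linarith
    then show ?thesis by simp
  qed (simp add: assms(4))
  have "(LINT x|lborel. f x) = (LINT x|lborel. indicator {-M..M} x *\<^sub>R f x)"
    using eq by (intro Bochner_Integration.integral_cong refl)
  also have "\<dots> = F M - F (- M)"
    by (rule integral_FTC_atLeastAtMost)
       (auto intro: has_vector_derivative_at_within F continuous_on_subset[OF f] simp: M_def)
  also have "\<dots> = 0" using assms(3)[of M] assms(3)[of "-M"] by (simp add: M_def)
  finally show ?thesis .
qed

lemma has_weak_deriv_integral:
  "has_weak_deriv u v \<Longrightarrow> test_fun \<phi> \<Longrightarrow> (LINT x|lborel. u x * vderiv \<phi> x) = - (LINT x|lborel. v x * \<phi> x)"
  unfolding has_weak_deriv_def by blast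

lemma has_weak_deriv_locally_integrable:
  assumes "has_weak_deriv u v" shows "locally_integrable u" "locally_integrable v"
  using assms unfolding has_weak_deriv_def by blast+

lemma has_weak_deriv_classical:
  assumes u: "\<And>x. (u has_vector_derivative u' x) (at x)" and c: "continuous_on UNIV u'"
  shows "has_weak_deriv u u'"
  unfolding has_weak_deriv_def
proof (intro conjI allI impI)
  have cu: "continuous_on UNIV u"
    by (meson continuous_at_imp_continuous_on has_vector_derivative_continuous u)
  show l: "locally_integrable u" "locally_integrable u'"
    using c cu by (simp_all add: continuous_locally_integrable)
  fix \<phi> assume \<phi>: "test_fun \<phi>"
  obtain L where L: "\<And>x. \<bar>x\<bar> > L \<Longrightarrow> \<phi> x = 0" "\<And>x. \<bar>x\<bar> > L \<Longrightarrow> vderiv \<phi> x = 0"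
    using test_funE[OF \<phi>] by metis
  have "(LINT x|lborel. u x * vderiv \<phi> x + u' x * \<phi> x) = 0"
  proof (rule integral_deriv_compact_support[where L=L])
    show "((\<lambda>x. u x * \<phi> x) has_vector_derivative u x * vderiv \<phi> x + u' x * \<phi> x) (at x)" for x
      by (intro has_vector_derivative_mult u smooth_has_vderiv test_fun_smooth \<phi>)
    show "continuous_on UNIV (\<lambda>x. u x * vderiv \<phi> x + u' x * \<phi> x)"
      by (intro continuous_intros c cu smooth_continuous smooth_vderiv test_fun_smooth \<phi>)
  qed (simp_all add: L)
  moreover have "integrable lborel (\<lambda>x. u x * vderiv \<phi> x)" "integrable lborel (\<lambda>x. u' x * \<phi> x)"
    using locally_integrable_test_integrable l \<phi> test_fun_vderiv by blast+
  ultimately show "(LINT x|lborel. u x * vderiv \<phi> x) = - (LINT x|lborel. u' x * \<phi> x)"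
    by (simp add: eq_neg_iff_add_eq_0)
qed

lemma vderiv_mult:
  "smooth a \<Longrightarrow> smooth b \<Longrightarrow> vderiv (\<lambda>x. a x * b x) = (\<lambda>x. a x * vderiv b x + vderiv a x * b x)"
  by (intro vderiv_eqI has_vector_derivative_mult smooth_has_vderiv)

text \<open>
  If \<open>\<phi>\<close> is a test function, so is \<open>a \<phi>\<close>, and \<open>a \<phi>' = (a \<phi>)' - a' \<phi>\<close>.
\<close>

lemma has_weak_deriv_smooth_mult:
  assumes v: "has_weak_deriv v v'" and a: "smooth a"
  shows "has_weak_deriv (\<lambda>x. a x * v x) (\<lambda>x. vderiv a x * v x + a x * v' x)"
  unfolding has_weak_deriv_def
proof (intro conjI allI impI)
  have l: "locally_integrable v" "locally_integrable v'"
    using has_weak_deriv_locally_integrable[OF v] by simp_all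
  note c = smooth_continuous[OF a, of UNIV] smooth_continuous[OF smooth_vderiv[OF a], of UNIV]
  show "locally_integrable (\<lambda>x. a x * v x)"
    using l c by (simp add: locally_integrable_mult_continuous)
  show "locally_integrable (\<lambda>x. vderiv a x * v x + a x * v' x)"
    using l c by (simp add: locally_integrable_mult_continuous locally_integrable_add)
  fix \<phi> assume \<phi>: "test_fun \<phi>"
  note t = test_fun_mult[OF a \<phi>] test_fun_mult[OF smooth_vderiv[OF a] \<phi>] test_fun_mult[OF a test_fun_vderiv[OF \<phi>]]
  have "(LINT x|lborel. a x * v x * vderiv \<phi> x)
    = (LINT x|lborel. v x * vderiv (\<lambda>x. a x * \<phi> x) x - v x * (vderiv a x * \<phi> x))"
    unfolding vderiv_mult[OF a test_fun_smooth[OF \<phi>]] by (simp add: algebra_simps)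
  also have "\<dots> = (LINT x|lborel. v x * vderiv (\<lambda>x. a x * \<phi> x) x) - (LINT x|lborel. v x * (vderiv a x * \<phi> x))"
    by (intro Bochner_Integration.integral_diff locally_integrable_test_integrable l t test_fun_vderiv)
  also have "\<dots> = - (LINT x|lborel. v' x * (a x * \<phi> x)) - (LINT x|lborel. v x * (vderiv a x * \<phi> x))"
    using has_weak_deriv_integral[OF v t(1)] by simp
  also have "\<dots> = - ((LINT x|lborel. v x * (vderiv a x * \<phi> x)) + (LINT x|lborel. v' x * (a x * \<phi> x)))"
    by simp
  also have "\<dots> = - (LINT x|lborel. v x * (vderiv a x * \<phi> x) + v' x * (a x * \<phi> x))"
    by (subst Bochner_Integration.integral_add) (intro locally_integrable_test_integrable l t refl)+
  also have "\<dots> = - (LINT x|lborel. (vderiv a x * v x + a x * v' x) * \<phi> x)"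
    by (simp add: algebra_simps)
  finally show "(LINT x|lborel. a x * v x * vderiv \<phi> x) = - (LINT x|lborel. (vderiv a x * v x + a x * v' x) * \<phi> x)" .
qed

lemma has_weak_deriv_add:
  assumes u: "has_weak_deriv u u'" and v: "has_weak_deriv v v'"
  shows "has_weak_deriv (\<lambda>x. u x + v x) (\<lambda>x. u' x + v' x)"
  unfolding has_weak_deriv_def
proof (intro conjI allI impI)
  note l = has_weak_deriv_locally_integrable[OF u] has_weak_deriv_locally_integrable[OF v]
  show "locally_integrable (\<lambda>x. u x + v x)" "locally_integrable (\<lambda>x. u' x + v' x)"
    using l by (simp_all add: locally_integrable_add)
  fix \<phi> assume \<phi>: "test_fun \<phi>"
  show "(LINT x|lborel. (u x + v x) * vderiv \<phi> x) = - (LINT x|lborel. (u' x + v' x) * \<phi> x)"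
    using has_weak_deriv_integral[OF u \<phi>] has_weak_deriv_integral[OF v \<phi>]
      locally_integrable_test_integrable[OF l(1) test_fun_vderiv[OF \<phi>]]
      locally_integrable_test_integrable[OF l(2) \<phi>]
      locally_integrable_test_integrable[OF l(3) test_fun_vderiv[OF \<phi>]]
      locally_integrable_test_integrable[OF l(4) \<phi>]
    by (simp add: ring_distribs)
qed

lemma test_fun_cnj:
  assumes "test_fun \<phi>" shows "test_fun (\<lambda>x. cnj (\<phi> x))"
proof -
  obtain L where L: "\<And>x. \<bar>x\<bar> > L \<Longrightarrow> \<phi> x = 0" using test_funE[OF assms] by metis
  show ?thesis by (rule test_funI[where L=L]) (simp_all add: L smooth_cnj(1) test_fun_smooth assms)
qed

lemma has_weak_deriv_cnj:
  assumes u: "has_weak_deriv u u'"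
  shows "has_weak_deriv (\<lambda>x. cnj (u x)) (\<lambda>x. cnj (u' x))"
  unfolding has_weak_deriv_def
proof (intro conjI allI impI)
  show "locally_integrable (\<lambda>x. cnj (u x))" "locally_integrable (\<lambda>x. cnj (u' x))"
    using has_weak_deriv_locally_integrable[OF u] by (simp_all add: locally_integrable_cnj)
  fix \<phi> assume \<phi>: "test_fun \<phi>"
  have "cnj (LINT x|lborel. u x * cnj (vderiv \<phi> x)) = cnj (- (LINT x|lborel. u' x * cnj (\<phi> x)))"
    using has_weak_deriv_integral[OF u test_fun_cnj[OF \<phi>]] smooth_cnj(2)[OF test_fun_smooth[OF \<phi>]] by simp
  then show "(LINT x|lborel. cnj (u x) * vderiv \<phi> x) = - (LINT x|lborel. cnj (u' x) * \<phi> x)"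
    unfolding complex_cnj_minus Bochner_Integration.integral_cnj[symmetric] complex_cnj_mult complex_cnj_cnj .
qed

section \<open>The fundamental lemma of the calculus of variations\<close>

text \<open>
  The rays generate the Borel sets and are stable under intersection, so the integral vanishes over every
  Borel set.
\<close>

lemma integral_zero_on_rays_AE_zero:
  fixes g :: cfun
  assumes g: "integrable lborel g" and z: "\<And>a. (LINT x:{a<..}|lborel. g x) = 0"
  shows "AE x in lborel. g x = 0"
proof (rule sigma_finite_measure.density_zero[OF lborel.sigma_finite_measure_axioms g])
  have si: "set_integrable lborel A g" if "A \<in> sets borel" for A
    using g that unfolding set_integrable_def by (intro integrable_mult_indicator) auto
  have total: "(LINT x|lborel. g x) = 0"
  proof -
    have "(\<lambda>n. LINT x|lborel. indicator {- real n<..} x *\<^sub>R g x) \<longlonglongrightarrow> (LINT x|lborel. g x)"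
    proof (rule integral_dominated_convergence)
      show "integrable lborel (\<lambda>x. norm (g x))" using g by simp
      show "AE x in lborel. (\<lambda>n. indicator {- real n<..} x *\<^sub>R g x) \<longlonglongrightarrow> g x"
      proof (rule AE_I2)
        fix x :: real
        obtain N :: nat where N: "- x < real N" using reals_Archimedean2 by blast
        have "\<forall>\<^sub>F n in sequentially. indicator {- real n<..} x *\<^sub>R g x = g x"
          using eventually_ge_at_top[of N] by eventually_elim (use N in \<open>auto simp: indicator_def\<close>)
        then show "(\<lambda>n. indicator {- real n<..} x *\<^sub>R g x) \<longlonglongrightarrow> g x" by (rule tendsto_eventually)
      qed
    qed (use g in \<open>auto simp: indicator_def\<close>)
    moreover have "(\<lambda>n. LINT x|lborel. indicator {- real n<..} x *\<^sub>R g x) = (\<lambda>n. 0)"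
      using z unfolding set_lebesgue_integral_def by simp
    ultimately show ?thesis using LIMSEQ_unique tendsto_const by metis
  qed
  have stable: "Int_stable (range (\<lambda>a::real. {a<..}))"
    unfolding Int_stable_def
  proof (intro ballI)
    fix A B :: "real set" assume "A \<in> range (\<lambda>a. {a<..})" "B \<in> range (\<lambda>a. {a<..})"
    then obtain a b where "A = {a<..}" "B = {b<..}" by blast
    then have "A \<inter> B = {max a b<..}" by auto
    then show "A \<inter> B \<in> range (\<lambda>a. {a<..})" by blast
  qed
  have subset_Pow: "range (\<lambda>a::real. {a<..}) \<subseteq> Pow UNIV" by simp
  have eq: "sigma_sets UNIV (range (\<lambda>a::real. {a<..})) = sets borel"
    unfolding borel_Ioi by simp
  fix A :: "real set" assume "A \<in> sets lborel"
  then have A: "A \<in> sigma_sets UNIV (range (\<lambda>a::real. {a<..}))" unfolding eq by simp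
  show "(LINT x:A|lborel. g x) = 0"
    using stable subset_Pow A
  proof (induction rule: sigma_sets_induct_disjoint)
    case (basic A) then show ?case using z by blast
  next
    case empty show ?case by (simp add: set_lebesgue_integral_def)
  next
    case (compl A)
    then have [measurable]: "A \<in> sets borel" unfolding eq by simp
    have "(LINT x:UNIV - A|lborel. g x) = (LINT x|lborel. g x - indicator A x *\<^sub>R g x)"
      unfolding set_lebesgue_integral_def
      by (rule Bochner_Integration.integral_cong) (auto simp: indicator_def)
    also have "\<dots> = (LINT x|lborel. g x) - (LINT x:A|lborel. g x)"
      unfolding set_lebesgue_integral_def
      by (rule Bochner_Integration.integral_diff) (use g si[of A] in \<open>auto simp: set_integrable_def\<close>)
    finally show ?case using compl total by simp
  next
    case (union A)
    then have A: "A i \<in> sets borel" for i unfolding eq by blast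
    have "(LINT x:(\<Union>i. A i)|lborel. g x) = (\<Sum>i. LINT x:A i|lborel. g x)"
      by (rule lebesgue_integral_countable_add) (use A union in \<open>auto intro!: si simp: disjoint_family_on_def\<close>)
    then show ?case using union by simp
  qed
qed

lemma ramp_tendsto_1:
  assumes "filterlim f at_top sequentially"
  shows "(\<lambda>n. ramp (f n)) \<longlonglongrightarrow> 1"
proof -
  have "(\<lambda>n. exp (- inverse (f n))) \<longlonglongrightarrow> exp (- 0)"
    by (intro tendsto_exp tendsto_minus tendsto_inverse_0_at_top assms)
  moreover have "\<forall>\<^sub>F n in sequentially. exp (- inverse (f n)) = ramp (f n)"
    using assms[unfolded filterlim_at_top_dense, rule_format, of 0] by eventually_elim (simp add: ramp_def)
  ultimately show ?thesis using Lim_transform_eventually by fastforce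
qed

text \<open>
  The test functions \<open>e(n (x - a)) e(n (n - x))\<close>, with \<open>e\<close> the flat ramp, are bounded by 1 and converge pointwise to
  the indicator of the ray \<open>x > a\<close>; by dominated convergence \<open>g\<close> integrates to zero over every ray.
\<close>

lemma fundamental_lemma:
  assumes g: "integrable lborel g" and z: "\<And>\<phi>. test_fun \<phi> \<Longrightarrow> (LINT x|lborel. g x * \<phi> x) = 0"
  shows "AE x in lborel. g x = 0"
proof (rule integral_zero_on_rays_AE_zero[OF g])
  fix a :: real
  define \<phi> where "\<phi> = (\<lambda>(n::nat) x. complex_of_real (ramp (real n * x + - (real n * a))) * complex_of_real (ramp (- real n * x + real n * real n)))"
  have sm: "smooth (\<phi> n)" for n
    unfolding \<phi>_def by (intro smooth_mult smooth_affine[OF smooth_ramp])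
  have t: "test_fun (\<phi> n)" for n
  proof (rule test_funI[OF sm])
    fix x :: real assume x: "\<bar>x\<bar> > \<bar>a\<bar> + real n"
    then have "x \<le> a \<or> real n \<le> x" by linarith
    then have "real n * x + - (real n * a) \<le> 0 \<or> - real n * x + real n * real n \<le> 0"
      by (auto intro: mult_left_mono)
    then have "ramp (real n * x + - (real n * a)) = 0 \<or> ramp (- real n * x + real n * real n) = 0"
      using ramp_bounds(3) by blast
    then show "\<phi> n x = 0" unfolding \<phi>_def by auto
  qed
  have gm [measurable]: "g \<in> borel_measurable lborel" using g by simp
  have "(\<lambda>n. LINT x|lborel. g x * \<phi> n x) \<longlonglongrightarrow> (LINT x|lborel. indicator {a<..} x *\<^sub>R g x)"
  proof (rule integral_dominated_convergence)
    show "integrable lborel (\<lambda>x. norm (g x))" using g by simp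
    show "(\<lambda>x. g x * \<phi> n x) \<in> borel_measurable lborel" for n
      using locally_integrable_test_integrable[OF _ t] g borel_measurable_continuous_onI[OF smooth_continuous[OF sm], of n]
      by measurable
    show "AE x in lborel. norm (g x * \<phi> n x) \<le> norm (g x)" for n
    proof (rule AE_I2)
      fix x
      have "\<bar>ramp (real n * x + - (real n * a)) * ramp (- real n * x + real n * real n)\<bar> \<le> 1"
        unfolding abs_mult using ramp_bounds(1,2) by (intro mult_le_one) auto
      then have "cmod (\<phi> n x) \<le> 1" unfolding \<phi>_def by (simp add: norm_mult abs_mult)
      then show "norm (g x * \<phi> n x) \<le> norm (g x)"
        unfolding norm_mult by (simp add: mult_left_le)
    qed
    show "AE x in lborel. (\<lambda>n. g x * \<phi> n x) \<longlonglongrightarrow> indicator {a<..} x *\<^sub>R g x"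
    proof (rule AE_I2)
      fix x
      show "(\<lambda>n. g x * \<phi> n x) \<longlonglongrightarrow> indicator {a<..} x *\<^sub>R g x"
      proof (cases "x > a")
        case True
        have f1: "filterlim (\<lambda>n. real n * (x - a)) at_top sequentially"
          using True by (intro filterlim_at_top_mult_tendsto_pos[OF tendsto_const] filterlim_real_sequentially) auto
        have "filterlim (\<lambda>n. real n * (- x + real n)) at_top sequentially"
          by (intro filterlim_at_top_mult_at_top filterlim_real_sequentially filterlim_tendsto_add_at_top[OF tendsto_const])
        then have "(\<lambda>n. ramp (- real n * x + real n * real n)) \<longlonglongrightarrow> 1"
          by (intro ramp_tendsto_1) (simp add: algebra_simps)
        moreover have "(\<lambda>n. ramp (real n * x + - (real n * a))) \<longlonglongrightarrow> 1"
          using f1 by (intro ramp_tendsto_1) (simp add: algebra_simps)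
        ultimately have "(\<lambda>n. g x * \<phi> n x) \<longlonglongrightarrow> g x * (complex_of_real 1 * complex_of_real 1)"
          unfolding \<phi>_def by (intro tendsto_intros)
        then show ?thesis using True by simp
      next
        case False
        then have "real n * x + - (real n * a) \<le> 0" for n by (simp add: mult_left_mono)
        then have "\<phi> n x = 0" for n unfolding \<phi>_def using ramp_bounds(3) by simp
        then show ?thesis using False by simp
      qed
    qed
  qed (use g in measurable)
  then have "(LINT x|lborel. indicator {a<..} x *\<^sub>R g x) = 0"
    unfolding z[OF t] LIMSEQ_const_iff by simp
  then show "(LINT x:{a<..}|lborel. g x) = 0" by (simp add: set_lebesgue_integral_def)
qed

section \<open>Dilated cutoffs\<close>

definition dilated_cutoff :: "real \<Rightarrow> cfun" where
  "dilated_cutoff R x = cutoff (inverse R * x)"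

lemma dilated_cutoff_smooth: "smooth (dilated_cutoff R)"
  using smooth_affine[OF cutoff_smooth, of "inverse R" 0] by (simp add: dilated_cutoff_def[abs_def])

lemma dilated_cutoff_eq_1: "R > 0 \<Longrightarrow> \<bar>x\<bar> \<le> R \<Longrightarrow> dilated_cutoff R x = 1"
  unfolding dilated_cutoff_def by (rule cutoff_eq_1) (simp add: abs_mult field_simps)

lemma dilated_cutoff_eq_0: "R > 0 \<Longrightarrow> \<bar>x\<bar> \<ge> 2 * R \<Longrightarrow> dilated_cutoff R x = 0"
  unfolding dilated_cutoff_def by (rule cutoff_eq_0) (simp add: abs_mult field_simps)

lemma dilated_cutoff_le_1: "cmod (dilated_cutoff R x) \<le> 1"
  unfolding dilated_cutoff_def by (rule cutoff_le_1)

lemma has_vector_derivative_dilate: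
  assumes "smooth f"
  shows "((\<lambda>x. f (c * x)) has_vector_derivative complex_of_real c * vderiv f (c * x)) (at x)"
proof -
  have "((\<lambda>x. c * x) has_vector_derivative c) (at x)"
    by (auto intro!: derivative_eq_intros)
  from vector_diff_chain_at[OF this smooth_has_vderiv[OF assms]] show ?thesis
    by (simp add: o_def scaleR_conv_of_real)
qed

lemma vderiv_dilated_cutoff:
  "vderiv (dilated_cutoff R) = (\<lambda>x. complex_of_real (inverse R) * vderiv cutoff (inverse R * x))"
  unfolding dilated_cutoff_def[abs_def]
  by (intro vderiv_eqI has_vector_derivative_dilate cutoff_smooth)

lemma vderiv2_dilated_cutoff:
  "vderiv (vderiv (dilated_cutoff R)) = (\<lambda>x. complex_of_real (inverse R * inverse R) * vderiv (vderiv cutoff) (inverse R * x))"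
proof (rule vderiv_eqI)
  fix x
  have "((\<lambda>x. vderiv cutoff (inverse R * x)) has_vector_derivative complex_of_real (inverse R) * vderiv (vderiv cutoff) (inverse R * x)) (at x)"
    by (intro has_vector_derivative_dilate smooth_vderiv cutoff_smooth)
  from has_vector_derivative_mult_right[OF this, of "complex_of_real (inverse R)"]
  show "(vderiv (dilated_cutoff R) has_vector_derivative complex_of_real (inverse R * inverse R) * vderiv (vderiv cutoff) (inverse R * x)) (at x)"
    unfolding vderiv_dilated_cutoff by (simp add: mult.assoc)
qed

lemma vderiv_eq_0_locally_const:
  assumes "open S" "x \<in> S" "\<And>y. y \<in> S \<Longrightarrow> f y = c"
  shows "vderiv f x = 0"
  unfolding vderiv_def
  by (rule vector_derivative_at)
     (rule has_vector_derivative_transform_within_open[OF has_vector_derivative_const assms(1,2)], simp add: assms(3))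

lemma vderiv_dilated_cutoff_eq_0: "R > 0 \<Longrightarrow> \<bar>x\<bar> < R \<Longrightarrow> vderiv (dilated_cutoff R) x = 0"
  by (rule vderiv_eq_0_locally_const[where S="{-R<..<R}" and c=1])
     (auto intro!: dilated_cutoff_eq_1)

lemma dilated_cutoff_test: "R > 0 \<Longrightarrow> test_fun (dilated_cutoff R)"
  by (rule test_funI[OF dilated_cutoff_smooth, of "2 * R"]) (simp add: dilated_cutoff_eq_0)

lemma cutoff_test: "test_fun cutoff"
  by (rule test_funI[OF cutoff_smooth, of 2]) (simp add: cutoff_eq_0)

section \<open>Integration by parts for weak derivatives\<close>

lemma test_fun_bounded:
  assumes "test_fun \<phi>"
  obtains B where "B > 0" "\<And>x. cmod (\<phi> x) \<le> B"
proof -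
  obtain L where L: "\<And>x. \<bar>x\<bar> > L \<Longrightarrow> \<phi> x = 0" using test_funE[OF assms] by metis
  have "bounded (\<phi> ` {-L..L})"
    by (intro compact_imp_bounded compact_continuous_image smooth_continuous test_fun_smooth assms) simp
  then obtain B where B: "B > 0" "\<forall>y \<in> \<phi> ` {-L..L}. cmod y \<le> B" unfolding bounded_pos by blast
  have "cmod (\<phi> x) \<le> B" for x
  proof (cases "\<bar>x\<bar> > L")
    case False
    then have "x \<in> {-L..L}" unfolding atLeastAtMost_iff by linarith
    then show ?thesis using B(2) by blast
  qed (use L B(1) in simp)
  with B(1) show ?thesis by (rule that)
qed

lemma continuous_antiderivative:
  fixes f :: "real \<Rightarrow> 'a::euclidean_space"
  assumes "continuous_on UNIV f"
  obtains F where "\<And>x. (F has_vector_derivative f x) (at x)"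
proof -
  have "\<exists>F. \<forall>x::real. - \<infinity> < ereal x \<longrightarrow> ereal x < \<infinity> \<longrightarrow> (F has_vector_derivative f x) (at x)"
    by (rule einterval_antiderivative) (use assms in \<open>auto simp: continuous_on_eq_continuous_at\<close>)
  then show ?thesis using that by auto
qed

lemma Fubini_triangle:
  fixes f g :: cfun
  assumes f: "integrable lborel f" and g: "integrable lborel g"
  shows "(LINT t|lborel. f t * (LINT x|lborel. (if t < x then g x else 0)))
       = (LINT x|lborel. g x * (LINT t|lborel. (if t < x then f t else 0)))" (is ?eq)
    and "integrable lborel (\<lambda>x. g x * (LINT t|lborel. (if t < x then f t else 0)))" (is ?int)
proof -
  define h where "h = (\<lambda>t x. if t < x then f t * g x else 0)"
  have [measurable]: "f \<in> borel_measurable borel" "g \<in> borel_measurable borel"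
    using f g by (simp_all add: borel_measurable_integrable)
  have i1: "integrable (lborel \<Otimes>\<^sub>M lborel) (\<lambda>p. f (fst p) * g (snd p))"
  proof (rule lborel_pair.Fubini_integrable)
    show "(\<lambda>p. f (fst p) * g (snd p)) \<in> borel_measurable (lborel \<Otimes>\<^sub>M lborel)" by measurable
    show "integrable lborel (\<lambda>x. LINT y|lborel. norm (f (fst (x, y)) * g (snd (x, y))))"
      using f by (simp add: norm_mult)
    show "AE x in lborel. integrable lborel (\<lambda>y. f (fst (x, y)) * g (snd (x, y)))"
      using g by simp
  qed
  have hi: "integrable (lborel \<Otimes>\<^sub>M lborel) (case_prod h)"
  proof (rule Bochner_Integration.integrable_bound[OF i1])
    have "(\<lambda>p. if fst p < snd p then f (fst p) * g (snd p) else 0) \<in> borel_measurable (lborel \<Otimes>\<^sub>M (lborel :: real measure))"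
      by measurable
    then show "case_prod h \<in> borel_measurable (lborel \<Otimes>\<^sub>M lborel)"
      by (simp add: h_def case_prod_beta')
    show "AE p in lborel \<Otimes>\<^sub>M lborel. norm (case_prod h p) \<le> norm (f (fst p) * g (snd p))"
      by (auto simp: h_def)
  qed
  have a: "(LINT x|lborel. h t x) = f t * (LINT x|lborel. (if t < x then g x else 0))" for t
  proof -
    have "h t = (\<lambda>x. f t * (if t < x then g x else 0))" by (auto simp: h_def)
    then show ?thesis by simp
  qed
  have b: "(LINT t|lborel. h t x) = g x * (LINT t|lborel. (if t < x then f t else 0))" for x
  proof -
    have "(\<lambda>t. h t x) = (\<lambda>t. g x * (if t < x then f t else 0))" by (auto simp: h_def)
    then show ?thesis by simp
  qed
  show ?eq using lborel_pair.Fubini_integral[OF hi] unfolding a b by simp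
  show ?int using lborel_pair.integrable_snd[OF hi] unfolding b .
qed

text \<open>
  The compact support removes the constant of integration. Let \<open>\<Psi>(t) = \<integral> \<phi>\<close> over \<open>x > t\<close> for a test function \<open>\<phi>\<close>.
  Multiplied by a cutoff that is 1 on the supports of \<open>w\<close> and \<open>w'\<close>, it becomes a test function with
  \<open>w \<Psi>' = - w \<phi>\<close>, so that \<open>\<integral> w \<phi> = \<integral> w' \<Psi>\<close>; by Fubini this is \<open>\<integral> \<phi> W\<close> with \<open>W(x)\<close> the integral of \<open>w'\<close> over
  \<open>t < x\<close>. The fundamental lemma gives \<open>w = W\<close>. Testing against the cutoff alone shows that
  \<open>w'\<close> has integral zero, which makes \<open>W\<close> vanish to the right of the support.
\<close>

lemma weak_deriv_compact_support:
  assumes w: "has_weak_deriv w w'" and M: "M > 0"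
    and "\<forall>x. \<bar>x\<bar> \<ge> M \<longrightarrow> w x = 0" "\<forall>x. \<bar>x\<bar> \<ge> M \<longrightarrow> w' x = 0"
  shows "integrable lborel w'" (is ?int)
    and "(LINT x|lborel. w' x) = 0" (is ?zero)
    and "AE x in lborel. w x = (LINT t|lborel. (if t < x then w' t else 0))" (is ?prim)
proof -
  have z: "w x = 0" "w' x = 0" if "\<bar>x\<bar> \<ge> M" for x using assms that by blast+
  note l = has_weak_deriv_locally_integrable[OF w]
  have wi: "integrable lborel w" by (rule locally_integrable_compact_support[OF l(1), of M]) (simp add: z)
  show wi': ?int by (rule locally_integrable_compact_support[OF l(2), of M]) (simp add: z)
  show zero: ?zero
  proof -
    have e1: "w x * vderiv (dilated_cutoff M) x = 0" for x
      using z(1)[of x] vderiv_dilated_cutoff_eq_0[OF M, of x] by (cases "\<bar>x\<bar> < M") auto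
    have e2: "w' x * dilated_cutoff M x = w' x" for x
      using z(2)[of x] dilated_cutoff_eq_1[OF M, of x] by (cases "\<bar>x\<bar> < M") auto
    show ?thesis using has_weak_deriv_integral[OF w dilated_cutoff_test[OF M]] unfolding e1 e2 by simp
  qed
  define W where "W x = (LINT t|lborel. (if t < x then w' t else 0))" for x
  have W0: "W x = 0" if "\<bar>x\<bar> \<ge> M" for x
  proof (cases "x \<le> - M")
    case True
    then have "(if t < x then w' t else 0) = 0" for t using z(2)[of t] M by auto
    then show ?thesis by (simp add: W_def)
  next
    case False
    then have "x \<ge> M" using that by linarith
    then have "(if t < x then w' t else 0) = w' t" for t using z(2)[of t] by auto
    then show ?thesis using zero by (simp add: W_def)
  qed
  have Wi: "integrable lborel W"
  proof -
    have "integrable lborel (\<lambda>x. dilated_cutoff M x * W x)"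
      unfolding W_def by (rule Fubini_triangle(2)[OF wi' test_fun_integrable[OF dilated_cutoff_test[OF M]]])
    moreover have "dilated_cutoff M x * W x = W x" for x
      using W0[of x] dilated_cutoff_eq_1[OF M, of x] by (cases "\<bar>x\<bar> < M") auto
    ultimately show ?thesis by simp
  qed
  have "AE x in lborel. w x - W x = 0"
  proof (rule fundamental_lemma)
    show "integrable lborel (\<lambda>x. w x - W x)" using wi Wi by simp
    fix \<phi> assume \<phi>: "test_fun \<phi>"
    note sm = test_fun_smooth[OF \<phi>]
    obtain L where L: "L > 0" "\<And>x. \<bar>x\<bar> > L \<Longrightarrow> \<phi> x = 0" using test_funE[OF \<phi>] by metis
    define B where "B = max L M"
    obtain F where F: "\<And>x. (F has_vector_derivative \<phi> x) (at x)"
      using continuous_antiderivative[OF smooth_continuous[OF sm]] by metis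
    have tail: "(LINT x|lborel. (if t < x then \<phi> x else 0)) = F B - F t" if "t < M" for t
    proof -
      have "(LINT x|lborel. (if t < x then \<phi> x else 0)) = (LINT x|lborel. indicator {t..B} x *\<^sub>R \<phi> x)"
      proof (rule integral_cong_AE)
        have [measurable]: "\<phi> \<in> borel_measurable borel"
          by (intro borel_measurable_continuous_onI smooth_continuous sm)
        show "(\<lambda>x. if t < x then \<phi> x else 0) \<in> borel_measurable lborel" by measurable
        show "(\<lambda>x. indicator {t..B} x *\<^sub>R \<phi> x) \<in> borel_measurable lborel" by measurable
        show "AE x in lborel. (if t < x then \<phi> x else 0) = indicator {t..B} x *\<^sub>R \<phi> x"
          using AE_lborel_singleton[of t]
        proof eventually_elim
          case (elim x)
          show ?case
          proof (cases "x > B")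
            case True
            then have "\<bar>x\<bar> > L" using L(1) by (simp add: B_def)
            then show ?thesis using L(2) True by simp
          qed (use elim in \<open>auto simp: indicator_def\<close>)
        qed
      qed
      also have "\<dots> = F B - F t"
        by (rule integral_FTC_atLeastAtMost)
           (use that in \<open>auto intro: has_vector_derivative_at_within F smooth_continuous[OF sm] simp: B_def\<close>)
      finally show ?thesis .
    qed
    define G where "G x = F B - F x" for x
    have G: "(G has_vector_derivative - \<phi> x) (at x)" for x
      unfolding G_def using has_vector_derivative_diff[OF has_vector_derivative_const F, of "F B" x] by simp
    have smG: "smooth G"
      by (rule smooth_antiderivative[OF G]) (use smooth_mult[OF smooth_const sm, of "-1"] in simp)
    define \<psi> where "\<psi> x = G x * dilated_cutoff M x" for x
    have t\<psi>: "test_fun \<psi>"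
      unfolding \<psi>_def by (rule test_fun_mult[OF smG dilated_cutoff_test[OF M]])
    have d\<psi>: "vderiv \<psi> = (\<lambda>x. G x * vderiv (dilated_cutoff M) x + vderiv G x * dilated_cutoff M x)"
      unfolding \<psi>_def[abs_def] by (rule vderiv_mult[OF smG dilated_cutoff_smooth])
    have e1: "w x * vderiv \<psi> x = - (w x * \<phi> x)" for x
      unfolding d\<psi> vderiv_eqI[OF G]
      using z(1)[of x] dilated_cutoff_eq_1[OF M, of x] vderiv_dilated_cutoff_eq_0[OF M, of x]
      by (cases "\<bar>x\<bar> < M") auto
    have e2: "w' x * \<psi> x = w' x * (LINT y|lborel. (if x < y then \<phi> y else 0))" for x
      unfolding \<psi>_def using z(2)[of x] dilated_cutoff_eq_1[OF M, of x] tail[of x]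
      by (cases "\<bar>x\<bar> < M") (auto simp: G_def)
    have "(LINT x|lborel. w x * \<phi> x) = (LINT x|lborel. w' x * (LINT y|lborel. (if x < y then \<phi> y else 0)))"
      using has_weak_deriv_integral[OF w t\<psi>] unfolding e1 e2 by simp
    also have "\<dots> = (LINT x|lborel. \<phi> x * W x)"
      unfolding W_def by (rule Fubini_triangle(1)[OF wi' test_fun_integrable[OF \<phi>]])
    finally have eq: "(LINT x|lborel. w x * \<phi> x) = (LINT x|lborel. \<phi> x * W x)" .
    have "(LINT x|lborel. (w x - W x) * \<phi> x) = (LINT x|lborel. w x * \<phi> x - \<phi> x * W x)"
      by (simp add: algebra_simps)
    also have "\<dots> = (LINT x|lborel. w x * \<phi> x) - (LINT x|lborel. \<phi> x * W x)"
      using locally_integrable_test_integrable[OF l(1) \<phi>] Fubini_triangle(2)[OF wi' test_fun_integrable[OF \<phi>]]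
      unfolding W_def by (rule Bochner_Integration.integral_diff)
    finally show "(LINT x|lborel. (w x - W x) * \<phi> x) = 0" using eq by simp
  qed
  then show ?prim unfolding W_def by simp
qed

text \<open>
  After replacing \<open>u\<close> and \<open>v\<close> by the primitives of \<open>u'\<close> and \<open>v'\<close>, the two integrals are those of
  \<open>u'(s) v'(t)\<close> over the half planes \<open>t < s\<close> and \<open>s < t\<close>. Together they give \<open>(\<integral> u') (\<integral> v') = 0\<close>.
\<close>

lemma integration_by_parts_compact_support:
  assumes u: "has_weak_deriv u u'" and v: "has_weak_deriv v v'" and M: "M > 0"
    and zu: "\<forall>x. \<bar>x\<bar> \<ge> M \<longrightarrow> u x = 0" "\<forall>x. \<bar>x\<bar> \<ge> M \<longrightarrow> u' x = 0"
    and zv: "\<forall>x. \<bar>x\<bar> \<ge> M \<longrightarrow> v x = 0" "\<forall>x. \<bar>x\<bar> \<ge> M \<longrightarrow> v' x = 0"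
    and mu: "u \<in> borel_measurable lborel" "v \<in> borel_measurable lborel"
  shows "(LINT x|lborel. u' x * v x) + (LINT x|lborel. u x * v' x) = 0"
proof -
  note U = weak_deriv_compact_support[OF u M zu] and V = weak_deriv_compact_support[OF v M zv]
  note [measurable] = borel_measurable_integrable[OF U(1)] borel_measurable_integrable[OF V(1)] mu
  have m1: "(\<lambda>x. u' x * (LINT t|lborel. (if t < x then v' t else 0))) \<in> borel_measurable lborel"
    using Fubini_triangle(2)[OF V(1) U(1)] by (rule borel_measurable_integrable)
  have m2: "(\<lambda>x. v' x * (LINT t|lborel. (if t < x then u' t else 0))) \<in> borel_measurable lborel"
    using Fubini_triangle(2)[OF U(1) V(1)] by (rule borel_measurable_integrable)
  have "(LINT x|lborel. u' x * v x) = (LINT x|lborel. u' x * (LINT t|lborel. (if t < x then v' t else 0)))"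
  proof (rule integral_cong_AE[OF _ m1])
    show "(\<lambda>x. u' x * v x) \<in> borel_measurable lborel" by measurable
    show "AE x in lborel. u' x * v x = u' x * (LINT t|lborel. (if t < x then v' t else 0))"
      using V(3) by eventually_elim simp
  qed
  moreover have "(LINT x|lborel. u x * v' x) = (LINT x|lborel. v' x * (LINT t|lborel. (if t < x then u' t else 0)))"
  proof (rule integral_cong_AE[OF _ m2])
    show "(\<lambda>x. u x * v' x) \<in> borel_measurable lborel" by measurable
    show "AE x in lborel. u x * v' x = v' x * (LINT t|lborel. (if t < x then u' t else 0))"
      using U(3) by eventually_elim simp
  qed
  moreover have "(LINT x|lborel. v' x * (LINT t|lborel. (if t < x then u' t else 0)))
      = (LINT t|lborel. - (u' t * (LINT x|lborel. (if x < t then v' x else 0))))"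
  proof -
    have "(LINT x|lborel. (if t < x then v' x else 0)) = - (LINT x|lborel. (if x < t then v' x else 0))" for t
    proof -
      have i: "integrable lborel (\<lambda>x. if t < x then v' x else 0)" "integrable lborel (\<lambda>x. if x < t then v' x else 0)"
        by (rule Bochner_Integration.integrable_bound[OF V(1)]; (measurable | simp))+
      have "(LINT x|lborel. (if t < x then v' x else 0) + (if x < t then v' x else 0)) = (LINT x|lborel. v' x)"
      proof (rule integral_cong_AE)
        show "AE x in lborel. (if t < x then v' x else 0) + (if x < t then v' x else 0) = v' x"
          using AE_lborel_singleton[of t] by eventually_elim auto
      qed measurable
      then show ?thesis using V(2) i by (simp add: eq_neg_iff_add_eq_0)
    qed
    then show ?thesis using Fubini_triangle(1)[OF U(1) V(1)] by simp
  qed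
  ultimately show ?thesis by simp
qed

text \<open>
  Multiply both functions by a cutoff at scale \<open>n\<close>. The terms in which the cutoff is differentiated are
  \<open>O(1 / n)\<close> times \<open>u v\<close>, which is integrable, so dominated convergence removes the cutoff.
\<close>

lemma integration_by_parts_L2:
  assumes u: "has_weak_deriv u u'" and v: "has_weak_deriv v v'"
    and L2: "u \<in> L2" "u' \<in> L2" "v \<in> L2" "v' \<in> L2"
  shows "(LINT x|lborel. u' x * v x) = - (LINT x|lborel. u x * v' x)"
proof -
  obtain B where B: "B > 0" "\<And>x. cmod (vderiv cutoff x) \<le> B"
    using test_fun_bounded[OF test_fun_vderiv[OF cutoff_test]] by metis
  define \<kappa> where "\<kappa> n = dilated_cutoff (real (Suc n))" for n
  define \<kappa>' where "\<kappa>' n = vderiv (\<kappa> n)" for n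
  have sm: "smooth (\<kappa> n)" for n unfolding \<kappa>_def by (rule dilated_cutoff_smooth)
  have [measurable]: "\<kappa> n \<in> borel_measurable borel" "\<kappa>' n \<in> borel_measurable borel" for n
    unfolding \<kappa>'_def by (intro borel_measurable_continuous_onI smooth_continuous smooth_vderiv sm)+
  note [measurable] = L2[THEN L2_measurable]
  have \<kappa>1: "cmod (\<kappa> n x) \<le> 1" for n x unfolding \<kappa>_def by (rule dilated_cutoff_le_1)
  have \<kappa>'B: "cmod (\<kappa>' n x) \<le> B * inverse (real (Suc n))" for n x
  proof -
    have "cmod (\<kappa>' n x) = inverse (real (Suc n)) * cmod (vderiv cutoff (inverse (real (Suc n)) * x))"
      unfolding \<kappa>'_def \<kappa>_def vderiv_dilated_cutoff norm_mult norm_of_real by simp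
    also have "\<dots> \<le> inverse (real (Suc n)) * B" by (intro mult_left_mono B) simp
    finally show ?thesis by (simp add: mult.commute)
  qed
  have \<kappa>'B1: "cmod (\<kappa>' n x) \<le> B" for n x
  proof -
    have "inverse (real (Suc n)) \<le> 1" by (simp add: field_simps)
    then have "B * inverse (real (Suc n)) \<le> B * 1" using B(1) by (intro mult_left_mono) auto
    then show ?thesis using \<kappa>'B[of n x] by simp
  qed
  define D where "D n x = (\<kappa>' n x * u x + \<kappa> n x * u' x) * (\<kappa> n x * v x) + \<kappa> n x * u x * (\<kappa>' n x * v x + \<kappa> n x * v' x)" for n x
  have D0: "(LINT x|lborel. D n x) = 0" for n
  proof -
    note wu = has_weak_deriv_smooth_mult[OF u sm[of n], folded \<kappa>'_def]
    note wv = has_weak_deriv_smooth_mult[OF v sm[of n], folded \<kappa>'_def]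
    \<comment> \<open>The cutoff vanishes from twice its scale on; beyond the larger radius every point has a neighbourhood where it vanishes, so its derivative vanishes as well.\<close>
    define M where "M = 3 * real (Suc n)"
    have M: "M > 0" by (simp add: M_def)
    have z: "\<kappa> n x = 0" "\<kappa>' n x = 0" if "\<bar>x\<bar> \<ge> M" for x
    proof -
      show "\<kappa> n x = 0" unfolding \<kappa>_def by (rule dilated_cutoff_eq_0) (use that in \<open>auto simp: M_def\<close>)
      have "open {x::real. \<bar>x\<bar> > 2 * real (Suc n)}" by (intro open_Collect_less continuous_intros)
      then show "\<kappa>' n x = 0" unfolding \<kappa>'_def \<kappa>_def
        by (rule vderiv_eq_0_locally_const[where c=0]) (use that in \<open>auto simp: M_def intro!: dilated_cutoff_eq_0\<close>)
    qed
    have mem: "(\<lambda>x. \<kappa> n x * u x) \<in> L2" "(\<lambda>x. \<kappa>' n x * u x + \<kappa> n x * u' x) \<in> L2"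
        "(\<lambda>x. \<kappa> n x * v x) \<in> L2" "(\<lambda>x. \<kappa>' n x * v x + \<kappa> n x * v' x) \<in> L2"
      using L2 \<kappa>1 \<kappa>'B1 by (auto intro!: L2_add L2_bounded_mult)
    have "(LINT x|lborel. (\<kappa>' n x * u x + \<kappa> n x * u' x) * (\<kappa> n x * v x))
        + (LINT x|lborel. \<kappa> n x * u x * (\<kappa>' n x * v x + \<kappa> n x * v' x)) = 0"
      by (rule integration_by_parts_compact_support[OF wu wv M])
         (simp_all add: z L2_measurable[OF mem(1)] L2_measurable[OF mem(3)])
    then show ?thesis unfolding D_def
      using L2_mult_integrable[OF mem(2,3)] L2_mult_integrable[OF mem(1,4)] by simp
  qed
  define W where "W x = (B * (cmod (u x) * cmod (v x)) + cmod (u' x) * cmod (v x)) + (B * (cmod (u x) * cmod (v x)) + cmod (u x) * cmod (v' x))" for x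
  have i: "integrable lborel (\<lambda>x. u x * v x)" "integrable lborel (\<lambda>x. u' x * v x)" "integrable lborel (\<lambda>x. u x * v' x)"
    using L2 by (auto intro: L2_mult_integrable)
  have "(\<lambda>n. LINT x|lborel. D n x) \<longlonglongrightarrow> (LINT x|lborel. u' x * v x + u x * v' x)"
  proof (rule integral_dominated_convergence)
    show "integrable lborel W"
      unfolding W_def norm_mult[symmetric]
      by (intro Bochner_Integration.integrable_add integrable_mult_right integrable_norm i)
    show "(\<lambda>x. u' x * v x + u x * v' x) \<in> borel_measurable lborel" by measurable
    show "D n \<in> borel_measurable lborel" for n unfolding D_def by measurable
    show "AE x in lborel. norm (D n x) \<le> W x" for n
    proof (rule AE_I2)
      fix x
      have a: "cmod (\<kappa> n x * r) \<le> cmod r" for r unfolding norm_mult using \<kappa>1 by (simp add: mult_left_le_one_le)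
      have b: "cmod (\<kappa>' n x * r) \<le> B * cmod r" for r unfolding norm_mult using \<kappa>'B1 by (simp add: mult_right_mono)
      have "norm (D n x) \<le> cmod (\<kappa>' n x * u x + \<kappa> n x * u' x) * cmod (\<kappa> n x * v x) + cmod (\<kappa> n x * u x) * cmod (\<kappa>' n x * v x + \<kappa> n x * v' x)"
        unfolding D_def norm_mult[symmetric] by (rule norm_triangle_ineq)
      also have "\<dots> \<le> (B * cmod (u x) + cmod (u' x)) * cmod (v x) + cmod (u x) * (B * cmod (v x) + cmod (v' x))"
        by (intro add_mono mult_mono a order_trans[OF norm_triangle_ineq] add_mono b) (use B(1) in auto)
      also have "\<dots> = W x" unfolding W_def by (simp add: algebra_simps)
      finally show "norm (D n x) \<le> W x" .
    qed
    show "AE x in lborel. (\<lambda>n. D n x) \<longlonglongrightarrow> u' x * v x + u x * v' x"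
    proof (rule AE_I2)
      fix x
      obtain N :: nat where N: "\<bar>x\<bar> < real N" using reals_Archimedean2 by blast
      have "\<forall>\<^sub>F n in sequentially. \<kappa> n x = 1"
        using eventually_ge_at_top[of N]
        by eventually_elim (use N in \<open>auto simp: \<kappa>_def intro!: dilated_cutoff_eq_1\<close>)
      then have l1: "(\<lambda>n. \<kappa> n x) \<longlonglongrightarrow> 1" by (rule tendsto_eventually)
      have "(\<lambda>n. B * inverse (real (Suc n))) \<longlonglongrightarrow> B * 0"
        by (intro tendsto_mult tendsto_const LIMSEQ_inverse_real_of_nat)
      then have "(\<lambda>n. B * inverse (real (Suc n))) \<longlonglongrightarrow> 0" by simp
      then have l2: "(\<lambda>n. \<kappa>' n x) \<longlonglongrightarrow> 0"
        by (rule Lim_null_comparison[rotated]) (simp add: \<kappa>'B del: of_nat_Suc)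
      have "(\<lambda>n. D n x) \<longlonglongrightarrow> (0 * u x + 1 * u' x) * (1 * v x) + 1 * u x * (0 * v x + 1 * v' x)"
        unfolding D_def by (intro tendsto_intros l1 l2)
      then show "(\<lambda>n. D n x) \<longlonglongrightarrow> u' x * v x + u x * v' x" by simp
    qed
  qed
  then have "(LINT x|lborel. u' x * v x + u x * v' x) = 0" unfolding D0 LIMSEQ_const_iff by simp
  then show ?thesis using i by (simp add: eq_neg_iff_add_eq_0)
qed

section \<open>Symmetry of the operator\<close>

lemma continuous_AE_zero:
  fixes f :: cfun
  assumes c: "continuous_on UNIV f" and z: "AE x in lborel. f x = 0"
  shows "f x = 0"
proof -
  have o: "open {x. f x \<noteq> 0}"
    using open_Collect_neq[OF c continuous_on_const, of 0] .
  have "AE x in lborel. x \<notin> {x. f x \<noteq> 0}" using z by simp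
  moreover have "{x. f x \<noteq> 0} \<in> sets lborel" using o by simp
  ultimately have "{x. f x \<noteq> 0} \<in> null_sets lborel" by (simp add: AE_iff_null_sets)
  then have "negligible {x. f x \<noteq> 0}"
    unfolding negligible_iff_null_sets by (rule null_sets_completionI)
  then show ?thesis using open_not_negligible[OF o] by blast
qed

lemma smooth_ident: "smooth (\<lambda>x. complex_of_real x)" "vderiv (\<lambda>x. complex_of_real x) = (\<lambda>_. 1)"
proof -
  have D: "((\<lambda>x. complex_of_real x) has_vector_derivative 1) (at x)" for x
    by (rule has_vector_derivative_of_real[OF DERIV_ident, simplified])
  show "smooth (\<lambda>x. complex_of_real x)" by (rule smooth_antiderivative[OF D smooth_const])
  show "vderiv (\<lambda>x. complex_of_real x) = (\<lambda>_. 1)" by (rule vderiv_eqI[OF D])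
qed

text \<open>
  Moving the derivative off \<open>\<phi>\<close> in the definition of formal self-adjointness, with \<open>\<eta>\<close> the conjugate of the second
  test function, leaves the integral of \<open>\<phi>\<close> against this expression, for every \<open>\<phi>\<close>.
\<close>

lemma formally_self_adjoint_pointwise:
  assumes a: "smooth a1" "smooth a0" and sa: "formally_self_adjoint (a1, a0)" and \<eta>: "test_fun \<eta>"
  shows "\<i> * (a1 x - cnj (a1 x)) * vderiv \<eta> x + (\<i> * vderiv a1 x + a0 x - cnj (a0 x)) * \<eta> x = 0"
proof -
  define E where "E x = (\<i> * (a1 x + (-1) * cnj (a1 x))) * vderiv \<eta> x + (\<i> * vderiv a1 x + a0 x + (-1) * cnj (a0 x)) * \<eta> x" for x
  note s\<eta> = test_fun_smooth[OF \<eta>]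
  have smE: "smooth E" unfolding E_def[abs_def]
    by (intro smooth_add smooth_mult smooth_const smooth_cnj smooth_vderiv a s\<eta>)
  obtain L where L: "\<And>x. \<bar>x\<bar> > L \<Longrightarrow> \<eta> x = 0" "\<And>x. \<bar>x\<bar> > L \<Longrightarrow> vderiv \<eta> x = 0"
    using test_funE[OF \<eta>] by metis
  have tE: "test_fun E" by (rule test_funI[OF smE, of L]) (simp add: E_def L)
  have "AE x in lborel. E x = 0"
  proof (rule fundamental_lemma[OF test_fun_integrable[OF tE]])
    fix \<phi> assume \<phi>: "test_fun \<phi>"
    define \<psi> where "\<psi> x = cnj (\<eta> x)" for x
    have t\<psi>: "test_fun \<psi>" unfolding \<psi>_def by (rule test_fun_cnj[OF \<eta>])
    have d\<psi>: "vderiv \<psi> = (\<lambda>x. cnj (vderiv \<eta> x))" unfolding \<psi>_def[abs_def] by (rule smooth_cnj(2)[OF s\<eta>])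
    note s\<phi> = test_fun_smooth[OF \<phi>]
    define b where "b x = a1 x * \<eta> x" for x
    have sb: "smooth b" unfolding b_def[abs_def] by (intro smooth_mult a s\<eta>)
    have db: "vderiv b = (\<lambda>x. a1 x * vderiv \<eta> x + vderiv a1 x * \<eta> x)"
      unfolding b_def[abs_def] by (intro vderiv_mult a s\<eta>)
    have tc: "integrable lborel (\<lambda>x. c x * \<phi> x)" "integrable lborel (\<lambda>x. c x * vderiv \<phi> x)" if "smooth c" for c
      using that \<phi> by (auto intro!: test_fun_integrable test_fun_mult test_fun_vderiv)
    have 1: "(LINT x|lborel. b x * vderiv \<phi> x) = - (LINT x|lborel. vderiv b x * \<phi> x)"
      by (rule has_weak_deriv_integral[OF has_weak_deriv_classical \<phi>])
         (auto intro: smooth_has_vderiv smooth_continuous smooth_vderiv sb)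
    have "(LINT x|lborel. app_op (a1, a0) \<phi> (vderiv \<phi>) x * cnj (\<psi> x))
        = (LINT x|lborel. (- \<i>) * (b x * vderiv \<phi> x) + (a0 x * \<eta> x) * \<phi> x)"
      unfolding app_op_def b_def \<psi>_def by (simp add: algebra_simps)
    also have "\<dots> = (LINT x|lborel. (- \<i>) * (b x * vderiv \<phi> x)) + (LINT x|lborel. (a0 x * \<eta> x) * \<phi> x)"
      by (intro Bochner_Integration.integral_add integrable_mult_right tc sb smooth_mult a s\<eta>)
    also have "(LINT x|lborel. (- \<i>) * (b x * vderiv \<phi> x)) = (LINT x|lborel. \<i> * (vderiv b x * \<phi> x))"
      unfolding integral_mult_right_zero 1 by simp
    also have "(LINT x|lborel. \<i> * (vderiv b x * \<phi> x)) + (LINT x|lborel. (a0 x * \<eta> x) * \<phi> x)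
      = (LINT x|lborel. \<i> * (vderiv b x * \<phi> x) + (a0 x * \<eta> x) * \<phi> x)"
      by (intro Bochner_Integration.integral_add[symmetric] integrable_mult_right tc smooth_vderiv sb smooth_mult a s\<eta>)
    finally have lhs: "(LINT x|lborel. app_op (a1, a0) \<phi> (vderiv \<phi>) x * cnj (\<psi> x))
      = (LINT x|lborel. \<i> * (vderiv b x * \<phi> x) + (a0 x * \<eta> x) * \<phi> x)" .
    have rhs: "(LINT x|lborel. \<phi> x * cnj (app_op (a1, a0) \<psi> (vderiv \<psi>) x))
      = (LINT x|lborel. (\<i> * cnj (a1 x) * vderiv \<eta> x + cnj (a0 x) * \<eta> x) * \<phi> x)"
      unfolding app_op_def d\<psi> unfolding \<psi>_def by (simp add: algebra_simps)
    have eq: "(LINT x|lborel. \<i> * (vderiv b x * \<phi> x) + (a0 x * \<eta> x) * \<phi> x)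
       = (LINT x|lborel. (\<i> * cnj (a1 x) * vderiv \<eta> x + cnj (a0 x) * \<eta> x) * \<phi> x)"
      using sa \<phi> t\<psi> unfolding formally_self_adjoint_def lhs[symmetric] rhs[symmetric] by blast
    have "(LINT x|lborel. E x * \<phi> x) = (LINT x|lborel. (\<i> * (vderiv b x * \<phi> x) + (a0 x * \<eta> x) * \<phi> x)
         - (\<i> * cnj (a1 x) * vderiv \<eta> x + cnj (a0 x) * \<eta> x) * \<phi> x)"
      unfolding E_def db by (simp add: algebra_simps)
    also have "\<dots> = (LINT x|lborel. \<i> * (vderiv b x * \<phi> x) + (a0 x * \<eta> x) * \<phi> x)
         - (LINT x|lborel. (\<i> * cnj (a1 x) * vderiv \<eta> x + cnj (a0 x) * \<eta> x) * \<phi> x)"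
      by (intro Bochner_Integration.integral_diff Bochner_Integration.integrable_add integrable_mult_right tc
          smooth_vderiv sb smooth_add smooth_mult smooth_const smooth_cnj a s\<eta>)
    finally show "(LINT x|lborel. E x * \<phi> x) = 0" using eq by simp
  qed
  then have "E x = 0" by (rule continuous_AE_zero[OF smooth_continuous[OF smE]])
  then show ?thesis by (simp add: E_def)
qed

text \<open>
  Test functions \<open>\<eta>\<close> with prescribed value and derivative at \<open>x\<close>, namely \<open>(1, 0)\<close> and \<open>(0, 1)\<close>, isolate the two
  coefficients of the pointwise identity.
\<close>

lemma formally_self_adjoint_coefficients:
  assumes a: "smooth a1" "smooth a0" and sa: "formally_self_adjoint (a1, a0)"
  shows "cnj (a1 x) = a1 x" and "cnj (a0 x) = a0 x + \<i> * vderiv a1 x"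
proof -
  note P = formally_self_adjoint_pointwise[OF a sa]
  define \<eta> where "\<eta> y = cutoff (y - x)" for y
  have s\<eta>: "smooth \<eta>" using smooth_affine[OF cutoff_smooth, of 1 "- x"] by (simp add: \<eta>_def[abs_def])
  have t\<eta>: "test_fun \<eta>"
    by (rule test_funI[OF s\<eta>, of "\<bar>x\<bar> + 2"]) (auto simp: \<eta>_def intro!: cutoff_eq_0)
  have \<eta>x: "\<eta> x = 1" by (simp add: \<eta>_def cutoff_eq_1)
  have d\<eta>: "vderiv \<eta> x = 0"
    by (rule vderiv_eq_0_locally_const[where S="{x-1<..<x+1}" and c=1]) (auto simp: \<eta>_def intro!: cutoff_eq_1)
  have 0: "\<i> * vderiv a1 x + a0 x - cnj (a0 x) = 0" using P[OF t\<eta>, of x] \<eta>x d\<eta> by simp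
  then show "cnj (a0 x) = a0 x + \<i> * vderiv a1 x" by (simp add: algebra_simps)
  define \<zeta> where "\<zeta> y = (complex_of_real y + complex_of_real (- x)) * \<eta> y" for y
  have sl: "smooth (\<lambda>y. complex_of_real y + complex_of_real (- x))" by (intro smooth_add smooth_ident smooth_const)
  have t\<zeta>: "test_fun \<zeta>" unfolding \<zeta>_def by (rule test_fun_mult[OF sl t\<eta>])
  have "vderiv \<zeta> x = (complex_of_real x + complex_of_real (- x)) * vderiv \<eta> x + vderiv (\<lambda>y. complex_of_real y + complex_of_real (- x)) x * \<eta> x"
    unfolding \<zeta>_def[abs_def] vderiv_mult[OF sl s\<eta>] ..
  moreover have "vderiv (\<lambda>y. complex_of_real y + complex_of_real (- x)) = (\<lambda>_. 1 + 0)"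
    using smooth_has_vderiv[OF smooth_ident(1)] unfolding smooth_ident(2)
    by (intro vderiv_eqI has_vector_derivative_add has_vector_derivative_const)
  ultimately have d\<zeta>: "vderiv \<zeta> x = 1" using \<eta>x by simp
  have "\<zeta> x = 0" by (simp add: \<zeta>_def)
  then have "\<i> * (a1 x - cnj (a1 x)) = 0" using P[OF t\<zeta>, of x] d\<zeta> by simp
  then show "cnj (a1 x) = a1 x" by simp
qed

lemma Diff1_bounded:
  assumes "(a1, a0) \<in> Diff1"
  obtains B where "\<And>x. cmod (a1 x) \<le> B" "\<And>x. cmod (vderiv a1 x) \<le> B" "\<And>x. cmod (a0 x) \<le> B"
proof -
  have b: "bounded (range ((vderiv ^^ n) a1))" "bounded (range ((vderiv ^^ n) a0))" for n
    using assms unfolding Diff1_def by auto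
  obtain B1 where B1: "\<And>x. cmod (a1 x) \<le> B1" using b(1)[of 0] unfolding bounded_iff by auto
  obtain B2 where B2: "\<And>x. cmod (vderiv a1 x) \<le> B2" using b(1)[of 1] unfolding bounded_iff by auto
  obtain B3 where B3: "\<And>x. cmod (a0 x) \<le> B3" using b(2)[of 0] unfolding bounded_iff by auto
  show ?thesis
    by (rule that[of "max B1 (max B2 B3)"]) (use B1 B2 B3 in \<open>auto simp: le_max_iff_disj\<close>)
qed

lemma Diff1_smooth: "(a1, a0) \<in> Diff1 \<Longrightarrow> smooth a1" "(a1, a0) \<in> Diff1 \<Longrightarrow> smooth a0"
  unfolding Diff1_def by auto

lemma smooth_measurable: "smooth a \<Longrightarrow> a \<in> borel_measurable lborel"
  using borel_measurable_continuous_onI[OF smooth_continuous] by simp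

lemma H_op_in_L2:
  assumes "(u, f) \<in> H_op Q" shows "u \<in> L2 \<and> f \<in> L2"
  using assms unfolding H_op_def H2_derivs_def by auto

lemma has_weak_deriv_cmult: "has_weak_deriv u u' \<Longrightarrow> has_weak_deriv (\<lambda>x. c * u x) (\<lambda>x. c * u' x)"
  using has_weak_deriv_smooth_mult[OF _ smooth_const, of u u' c] vderiv_eqI[of "\<lambda>_. c" "\<lambda>_. 0"] by simp

lemma H_op_linear:
  assumes "(u, f) \<in> H_op Q" "(w, g) \<in> H_op Q"
  shows "((\<lambda>x. u x + c * w x), (\<lambda>x. f x + c * g x)) \<in> H_op Q"
proof -
  obtain u' u'' where u: "H2_derivs u u' u''" "f \<in> L2" and f: "AE x in lborel. f x = - u'' x + app_op Q u u' x"
    using assms(1) unfolding H_op_def by auto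
  obtain w' w'' where w: "H2_derivs w w' w''" "g \<in> L2" and g: "AE x in lborel. g x = - w'' x + app_op Q w w' x"
    using assms(2) unfolding H_op_def by auto
  have "H2_derivs (\<lambda>x. u x + c * w x) (\<lambda>x. u' x + c * w' x) (\<lambda>x. u'' x + c * w'' x)"
    using u w unfolding H2_derivs_def
    by (auto intro: L2_add L2_cmult has_weak_deriv_add has_weak_deriv_cmult)
  moreover have "(\<lambda>x. f x + c * g x) \<in> L2" using u w by (intro L2_add L2_cmult)
  moreover have "AE x in lborel. f x + c * g x = - (u'' x + c * w'' x) + app_op Q (\<lambda>x. u x + c * w x) (\<lambda>x. u' x + c * w' x) x"
    using f g
  proof eventually_elim
    case (elim x)
    show ?case unfolding elim app_op_def by (simp add: algebra_simps)
  qed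
  ultimately show ?thesis unfolding H_op_def mem_Collect_eq prod.case by blast
qed

text \<open>
  Three integrations by parts, two for \<open>u''\<close> and one for \<open>a\<^sub>1 u'\<close>; the identities for the coefficients turn what
  falls on \<open>w\<close> into the conjugate of \<open>H w\<close>.
\<close>

lemma H_op_symmetric:
  assumes Q: "Q \<in> Diff1" and sa: "formally_self_adjoint Q"
    and uf: "(u, f) \<in> H_op Q" and wg: "(w, g) \<in> H_op Q"
  shows "(LINT x|lborel. f x * cnj (w x)) = (LINT x|lborel. u x * cnj (g x))"
proof -
  obtain a1 a0 where Qeq: "Q = (a1, a0)" by fastforce
  note D = Q[unfolded Qeq] and sa' = sa[unfolded Qeq]
  note s = Diff1_smooth[OF D]
  note c = formally_self_adjoint_coefficients[OF s sa']
  obtain B where B: "\<And>x. cmod (a1 x) \<le> B" "\<And>x. cmod (vderiv a1 x) \<le> B" "\<And>x. cmod (a0 x) \<le> B"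
    using Diff1_bounded[OF D] by metis
  note m = smooth_measurable[OF s(1)] smooth_measurable[OF smooth_vderiv[OF s(1)]] smooth_measurable[OF s(2)]
  obtain u' u'' where u: "u \<in> L2" "u' \<in> L2" "u'' \<in> L2" "has_weak_deriv u u'" "has_weak_deriv u' u''"
    and fL: "f \<in> L2" and f: "AE x in lborel. f x = - u'' x + app_op Q u u' x"
    using uf unfolding H_op_def H2_derivs_def by auto
  obtain w' w'' where w: "w \<in> L2" "w' \<in> L2" "w'' \<in> L2" "has_weak_deriv w w'" "has_weak_deriv w' w''"
    and gL: "g \<in> L2" and g: "AE x in lborel. g x = - w'' x + app_op Q w w' x"
    using wg unfolding H_op_def H2_derivs_def by auto
  define v v' v'' where "v = (\<lambda>x. cnj (w x))" and "v' = (\<lambda>x. cnj (w' x))" and "v'' = (\<lambda>x. cnj (w'' x))"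
  have v: "v \<in> L2" "v' \<in> L2" "v'' \<in> L2" "has_weak_deriv v v'" "has_weak_deriv v' v''"
    unfolding v_def v'_def v''_def using w by (auto intro: L2_cnj has_weak_deriv_cnj)
  have av: "(\<lambda>x. a1 x * v x) \<in> L2" "(\<lambda>x. a1 x * v' x) \<in> L2" "(\<lambda>x. vderiv a1 x * v x) \<in> L2" "(\<lambda>x. a0 x * v x) \<in> L2"
    by (rule L2_bounded_mult[OF v(1) m(1) B(1)] L2_bounded_mult[OF v(2) m(1) B(1)]
        L2_bounded_mult[OF v(1) m(2) B(2)] L2_bounded_mult[OF v(1) m(3) B(3)])+
  have av': "(\<lambda>x. vderiv a1 x * v x + a1 x * v' x) \<in> L2" using av by (intro L2_add)
  have i1: "(LINT x|lborel. u'' x * v x) = (LINT x|lborel. u x * v'' x)"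
    using integration_by_parts_L2[OF u(5) v(4) u(2,3) v(1,2)] integration_by_parts_L2[OF u(4) v(5) u(1,2) v(2,3)] by simp
  have i2: "(LINT x|lborel. u' x * (a1 x * v x)) = - (LINT x|lborel. u x * (vderiv a1 x * v x + a1 x * v' x))"
    by (rule integration_by_parts_L2[OF u(4) has_weak_deriv_smooth_mult[OF v(4) s(1)] u(1,2) av(1) av'])
  note I = L2_mult_integrable[OF u(3) v(1)] L2_mult_integrable[OF u(2) av(1)] L2_mult_integrable[OF u(1) av(4)]
    L2_mult_integrable[OF u(1) v(3)] L2_mult_integrable[OF u(1) av']
  have "(LINT x|lborel. f x * cnj (w x))
      = (LINT x|lborel. (- (u'' x * v x) + (- \<i>) * (u' x * (a1 x * v x))) + u x * (a0 x * v x))"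
  proof (rule integral_cong_AE)
    show "(\<lambda>x. f x * cnj (w x)) \<in> borel_measurable lborel"
      using L2_mult_integrable[OF fL L2_cnj[OF w(1)]] by (rule borel_measurable_integrable)
    show "(\<lambda>x. (- (u'' x * v x) + (- \<i>) * (u' x * (a1 x * v x))) + u x * (a0 x * v x)) \<in> borel_measurable lborel"
      by (intro borel_measurable_integrable Bochner_Integration.integrable_add Bochner_Integration.integrable_minus integrable_mult_right I)
    show "AE x in lborel. f x * cnj (w x) = (- (u'' x * v x) + (- \<i>) * (u' x * (a1 x * v x))) + u x * (a0 x * v x)"
      using f
    proof eventually_elim
      case (elim x)
      show ?case unfolding elim by (simp add: app_op_def Qeq v_def algebra_simps)
    qed
  qed
  also have "\<dots> = (- (LINT x|lborel. u'' x * v x) + (- \<i>) * (LINT x|lborel. u' x * (a1 x * v x))) + (LINT x|lborel. u x * (a0 x * v x))"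
    using I(1,2,3) by simp
  also have "\<dots> = (- (LINT x|lborel. u x * v'' x) + \<i> * (LINT x|lborel. u x * (vderiv a1 x * v x + a1 x * v' x))) + (LINT x|lborel. u x * (a0 x * v x))"
    unfolding i1 i2 by simp
  also have "\<dots> = (LINT x|lborel. (- (u x * v'' x) + \<i> * (u x * (vderiv a1 x * v x + a1 x * v' x))) + u x * (a0 x * v x))"
    using I(3,4,5) by simp
  also have "\<dots> = (LINT x|lborel. u x * cnj (g x))"
  proof (rule integral_cong_AE)
    show "(\<lambda>x. u x * cnj (g x)) \<in> borel_measurable lborel"
      using L2_mult_integrable[OF u(1) L2_cnj[OF gL]] by (rule borel_measurable_integrable)
    show "(\<lambda>x. (- (u x * v'' x) + \<i> * (u x * (vderiv a1 x * v x + a1 x * v' x))) + u x * (a0 x * v x)) \<in> borel_measurable lborel"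
      by (intro borel_measurable_integrable Bochner_Integration.integrable_add Bochner_Integration.integrable_minus integrable_mult_right I)
    show "AE x in lborel. (- (u x * v'' x) + \<i> * (u x * (vderiv a1 x * v x + a1 x * v' x))) + u x * (a0 x * v x) = u x * cnj (g x)"
      using g
    proof eventually_elim
      case (elim x)
      show ?case unfolding elim by (simp add: app_op_def Qeq v_def v'_def v''_def c algebra_simps)
    qed
  qed
  finally show ?thesis .
qed

lemma H_op_classicalI:
  assumes u: "\<And>x. (u has_vector_derivative u' x) (at x)" and u': "\<And>x. (u' has_vector_derivative u'' x) (at x)"
    and c: "continuous_on UNIV u''" and Q: "Q \<in> Diff1"
    and z: "\<And>x. \<bar>x\<bar> > L \<Longrightarrow> u x = 0" "\<And>x. \<bar>x\<bar> > L \<Longrightarrow> u' x = 0" "\<And>x. \<bar>x\<bar> > L \<Longrightarrow> u'' x = 0"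
  shows "(u, \<lambda>x. - u'' x + app_op Q u u' x) \<in> H_op Q"
proof -
  obtain a1 a0 where Qeq: "Q = (a1, a0)" by fastforce
  note s = Diff1_smooth[OF Q[unfolded Qeq]]
  have cu': "continuous_on UNIV u'" and cu: "continuous_on UNIV u"
    by (meson continuous_at_imp_continuous_on has_vector_derivative_continuous u u')+
  have L2: "h \<in> L2" if "continuous_on UNIV h" "\<And>x. \<bar>x\<bar> > L \<Longrightarrow> h x = 0" for h
  proof -
    have "locally_integrable (\<lambda>x. cnj (h x) * h x)"
      using that(1) by (intro continuous_locally_integrable continuous_intros)
    then have "integrable lborel (\<lambda>x. cnj (h x) * h x)"
      by (rule locally_integrable_compact_support[where L=L]) (simp add: that(2))
    then have "integrable lborel (\<lambda>x. Re (cnj (h x) * h x))" by (rule integrable_Re)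
    moreover have "Re (cnj (h x) * h x) = (cmod (h x))\<^sup>2" for x
      unfolding cmod_power2 by (simp add: power2_eq_square)
    ultimately show ?thesis using that(1) by (simp add: L2_def borel_measurable_continuous_onI)
  qed
  have "H2_derivs u u' u''"
    unfolding H2_derivs_def using L2 cu cu' c z has_weak_deriv_classical[OF u cu'] has_weak_deriv_classical[OF u' c] by auto
  moreover have "(\<lambda>x. - u'' x + app_op Q u u' x) \<in> L2"
  proof (rule L2)
    show "continuous_on UNIV (\<lambda>x. - u'' x + app_op Q u u' x)"
      unfolding app_op_def Qeq fst_conv snd_conv by (intro continuous_intros c cu cu' smooth_continuous s)
  qed (simp add: z app_op_def)
  ultimately show ?thesis unfolding H_op_def by auto
qed

section \<open>Uniformly bounded families\<close>

text \<open>
  Here \<open>s\<close> stands for \<open>1 / E\<close>. Differentiability is required for every real \<open>s\<close>, so that the derivative of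
  the family is unique and its properties can be collected over all orders; bounds are only uniform for
  \<open>0 < s \<le> 1\<close>.
\<close>

primrec symbol_upto :: "nat \<Rightarrow> (real \<Rightarrow> real \<Rightarrow> real) \<Rightarrow> bool" where
  "symbol_upto 0 F \<longleftrightarrow> (\<exists>C. \<forall>s\<in>{0<..1}. \<forall>x. \<bar>F s x\<bar> \<le> C)"
| "symbol_upto (Suc n) F \<longleftrightarrow> (\<exists>C. \<forall>s\<in>{0<..1}. \<forall>x. \<bar>F s x\<bar> \<le> C) \<and>
     (\<exists>F'. (\<forall>s x. (F s has_real_derivative F' s x) (at x)) \<and> symbol_upto n F')"

definition symbol :: "(real \<Rightarrow> real \<Rightarrow> real) \<Rightarrow> bool" where
  "symbol F \<longleftrightarrow> (\<forall>n. symbol_upto n F)"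

lemma symbol_upto_bound: "symbol_upto n F \<Longrightarrow> \<exists>C. \<forall>s\<in>{0<..1}. \<forall>x. \<bar>F s x\<bar> \<le> C"
  by (cases n) simp_all

lemma symbol_bound:
  assumes "symbol F" obtains C where "\<And>s x. 0 < s \<Longrightarrow> s \<le> 1 \<Longrightarrow> \<bar>F s x\<bar> \<le> C"
proof -
  have "symbol_upto 0 F" using assms unfolding symbol_def ..
  then obtain C where "\<forall>s\<in>{0<..1}. \<forall>x. \<bar>F s x\<bar> \<le> C" by auto
  then show ?thesis by (intro that[of C]) simp
qed

lemma symbol_upto_SucD: "symbol_upto (Suc n) F \<Longrightarrow> symbol_upto n F"
proof (induction n arbitrary: F)
  case (Suc n)
  then obtain F' where "\<forall>s x. (F s has_real_derivative F' s x) (at x)" "symbol_upto (Suc n) F'"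
    unfolding symbol_upto.simps(2)[of "Suc n" F] by blast
  then show ?case using Suc.IH[of F'] symbol_upto_bound[OF Suc.prems] unfolding symbol_upto.simps(2)[of n F] by blast
qed simp

lemma symbol_deriv:
  assumes "symbol F"
  obtains F' where "\<And>s x. (F s has_real_derivative F' s x) (at x)" "symbol F'"
proof -
  define F' where "F' s x = deriv (F s) x" for s x
  have *: "(\<forall>s x. (F s has_real_derivative F' s x) (at x)) \<and> symbol_upto n F'" for n
  proof -
    have "symbol_upto (Suc n) F" using assms unfolding symbol_def by blast
    then obtain G where G: "\<forall>s x. (F s has_real_derivative G s x) (at x)" "symbol_upto n G"
      unfolding symbol_upto.simps(2) by blast
    have "G s x = F' s x" for s x
      using DERIV_imp_deriv[OF G(1)[rule_format, of s x]] by (simp add: F'_def)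
    then have "G = F'" by (intro ext)
    then show ?thesis using G by simp
  qed
  then show ?thesis by (intro that[of F']) (simp_all add: symbol_def)
qed

lemma symbol_upto_SucI:
  assumes "symbol_upto 0 F" "\<And>s x. (F s has_real_derivative F' s x) (at x)" "symbol_upto n F'"
  shows "symbol_upto (Suc n) F"
  using assms unfolding symbol_upto.simps by blast

lemma symbol_upto_add: "symbol_upto n F \<Longrightarrow> symbol_upto n G \<Longrightarrow> symbol_upto n (\<lambda>s x. F s x + G s x)"
proof -
  have z: "symbol_upto 0 (\<lambda>s x. F s x + G s x)" if F0: "symbol_upto 0 F" and G0: "symbol_upto 0 G" for F G
  proof -
    obtain C where C: "\<forall>s\<in>{0<..1}. \<forall>x. \<bar>F s x\<bar> \<le> C" using F0 unfolding symbol_upto.simps(1) by blast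
    obtain D where D: "\<forall>s\<in>{0<..1}. \<forall>x. \<bar>G s x\<bar> \<le> D" using G0 unfolding symbol_upto.simps(1) by blast
    have "\<bar>F s x + G s x\<bar> \<le> C + D" if "s \<in> {0<..1}" for s x
      using C D that abs_triangle_ineq[of "F s x" "G s x"] by (meson add_mono order_trans)
    then show ?thesis unfolding symbol_upto.simps by blast
  qed
  show "symbol_upto n F \<Longrightarrow> symbol_upto n G \<Longrightarrow> symbol_upto n (\<lambda>s x. F s x + G s x)"
  proof (induction n arbitrary: F G)
    case 0 then show ?case by (rule z)
  next
    case (Suc n)
    have b: "symbol_upto 0 F" "symbol_upto 0 G"
      using Suc.prems[THEN symbol_upto_bound] by simp_all
    obtain F' G' where FG: "\<And>s x. (F s has_real_derivative F' s x) (at x)" "symbol_upto n F'"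
        "\<And>s x. (G s has_real_derivative G' s x) (at x)" "symbol_upto n G'"
      using Suc.prems unfolding symbol_upto.simps(2) by blast
    show ?case
      by (rule symbol_upto_SucI[OF z[OF b], where F'="\<lambda>s x. F' s x + G' s x"]) (auto intro!: DERIV_add FG Suc.IH)
  qed
qed

lemma symbol_upto_mult: "symbol_upto n F \<Longrightarrow> symbol_upto n G \<Longrightarrow> symbol_upto n (\<lambda>s x. F s x * G s x)"
proof -
  have z: "symbol_upto 0 (\<lambda>s x. F s x * G s x)" if F0: "symbol_upto 0 F" and G0: "symbol_upto 0 G" for F G
  proof -
    obtain C where C: "\<forall>s\<in>{0<..1}. \<forall>x. \<bar>F s x\<bar> \<le> C" using F0 unfolding symbol_upto.simps(1) by blast
    obtain D where D: "\<forall>s\<in>{0<..1}. \<forall>x. \<bar>G s x\<bar> \<le> D" using G0 unfolding symbol_upto.simps(1) by blast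
    have "\<bar>F s x * G s x\<bar> \<le> C * D" if "s \<in> {0<..1}" for s x
    proof -
      have "\<bar>F s x\<bar> \<le> C" "\<bar>G s x\<bar> \<le> D" using C D that by blast+
      then show ?thesis unfolding abs_mult by (intro mult_mono) auto
    qed
    then show ?thesis unfolding symbol_upto.simps by blast
  qed
  show "symbol_upto n F \<Longrightarrow> symbol_upto n G \<Longrightarrow> symbol_upto n (\<lambda>s x. F s x * G s x)"
  proof (induction n arbitrary: F G)
    case 0 then show ?case by (rule z)
  next
    case (Suc n)
    have b: "symbol_upto 0 F" "symbol_upto 0 G" "symbol_upto n F" "symbol_upto n G"
      using Suc.prems[THEN symbol_upto_bound] Suc.prems[THEN symbol_upto_SucD] by simp_all
    obtain F' G' where FG: "\<And>s x. (F s has_real_derivative F' s x) (at x)" "symbol_upto n F'"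
        "\<And>s x. (G s has_real_derivative G' s x) (at x)" "symbol_upto n G'"
      using Suc.prems unfolding symbol_upto.simps(2) by blast
    show ?case
      by (rule symbol_upto_SucI[OF z[OF b(1,2)], where F'="\<lambda>s x. F' s x * G s x + G' s x * F s x"])
         (auto intro!: DERIV_mult FG symbol_upto_add Suc.IH b)
  qed
qed

lemma symbol_upto_indep: "symbol_upto n (\<lambda>s x. c s)" if "\<And>s. 0 < s \<Longrightarrow> s \<le> 1 \<Longrightarrow> \<bar>c s\<bar> \<le> C"
  using that
proof (induction n arbitrary: c C)
  case 0 then show ?case by (auto intro!: exI[of _ C])
next
  case (Suc n)
  have "symbol_upto 0 (\<lambda>s x. c s)" using Suc.prems by (auto intro!: exI[of _ C])
  then show ?case by (rule symbol_upto_SucI[where F'="\<lambda>s x. 0"]) (use Suc.IH[of "\<lambda>_. 0" 0] in auto)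
qed

lemma symbol_add: "symbol F \<Longrightarrow> symbol G \<Longrightarrow> symbol (\<lambda>s x. F s x + G s x)"
  by (simp add: symbol_def symbol_upto_add)

lemma symbol_mult: "symbol F \<Longrightarrow> symbol G \<Longrightarrow> symbol (\<lambda>s x. F s x * G s x)"
  by (simp add: symbol_def symbol_upto_mult)

lemma symbol_const: "symbol (\<lambda>s x. c)"
  unfolding symbol_def using symbol_upto_indep[of "\<lambda>_. c" "\<bar>c\<bar>"] by simp

lemma symbol_parameter: "symbol (\<lambda>s x. s ^ k)"
  unfolding symbol_def using symbol_upto_indep[of "\<lambda>s. s ^ k" 1] by (simp add: power_le_one)

lemma symbol_parameter1: "symbol (\<lambda>s x. s)"
  using symbol_parameter[of 1] by simp

lemma symbol_diff: "symbol F \<Longrightarrow> symbol G \<Longrightarrow> symbol (\<lambda>s x. F s x - G s x)"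
  using symbol_add[of F "\<lambda>s x. (-1) * G s x"] symbol_mult[OF symbol_const, of G "-1"] by simp

lemma symbol_power: "symbol F \<Longrightarrow> symbol (\<lambda>s x. F s x ^ k)"
proof (induction k)
  case 0 then show ?case using symbol_const[of 1] by simp
next
  case (Suc k) then show ?case using symbol_mult[of F "\<lambda>s x. F s x ^ k"] by simp
qed

lemma symbol_Re:
  assumes "smooth a" "\<And>n. bounded (range ((vderiv ^^ n) a))"
  shows "symbol (\<lambda>s x. Re (a x))"
proof -
  have "symbol_upto n (\<lambda>s x. Re (a x))" for n
    using assms
  proof (induction n arbitrary: a)
    case 0
    obtain C where C: "\<And>x. cmod (a x) \<le> C" using 0(2)[of 0] unfolding bounded_iff by auto
    have "\<bar>Re (a x)\<bar> \<le> C" for x using abs_Re_le_cmod[of "a x"] C[of x] by linarith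
    then show ?case unfolding symbol_upto.simps by blast
  next
    case (Suc n)
    obtain C where C: "\<And>x. cmod (a x) \<le> C" using Suc.prems(2)[of 0] unfolding bounded_iff by auto
    have "\<bar>Re (a x)\<bar> \<le> C" for x using abs_Re_le_cmod[of "a x"] C[of x] by linarith
    then have z: "symbol_upto 0 (\<lambda>s x. Re (a x))" unfolding symbol_upto.simps by blast
    show ?case
    proof (rule symbol_upto_SucI[OF z])
      show "((\<lambda>x. Re (a x)) has_real_derivative Re (vderiv a x)) (at x)" for x
        unfolding has_real_derivative_iff_has_vector_derivative
        by (rule bounded_linear.has_vector_derivative[OF bounded_linear_Re smooth_has_vderiv[OF Suc.prems(1)]])
      have "bounded (range ((vderiv ^^ k) (vderiv a)))" for k
        using Suc.prems(2)[of "Suc k"] by (simp only: funpow_Suc_right comp_def)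
      then show "symbol_upto n (\<lambda>s x. Re (vderiv a x))"
        by (intro Suc.IH smooth_vderiv Suc.prems)
    qed
  qed
  then show ?thesis by (simp add: symbol_def)
qed

section \<open>Approximate solution of the phase equation\<close>

text \<open>
  The equation \<open>P + P'' / (4 P) - 5 P'\<^sup>2 / (16 P\<^sup>2) + V - E = 0\<close> for the squared local wave number \<open>P\<close>, written in terms of
  \<open>G = P / E\<close> and \<open>s = 1 / E\<close> and multiplied by \<open>s G\<^sup>2\<close>, which clears the denominators.
\<close>

definition eikonal :: "real \<Rightarrow> real \<Rightarrow> real \<Rightarrow> real \<Rightarrow> real \<Rightarrow> real" where
  "eikonal s V G G' G'' = G ^ 3 - (1 - s * V) * G\<^sup>2 + s * (G'' * G / 4 - 5 * G'\<^sup>2 / 16)"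

text \<open>
  One Newton step at \<open>G = 1\<close>, where \<open>G\<^sup>3 - G\<^sup>2\<close> has derivative 1: subtracting the error \<open>s \<sigma> r\<close> from \<open>G\<close> removes it to
  leading order. What remains carries a further factor \<open>s\<close>, either because \<open>G - 1\<close> does or because the error enters
  quadratically. Here \<open>\<sigma>\<close> will be \<open>s\<^sup>K\<close>, and \<open>r1\<close>, \<open>r2\<close> the derivatives of \<open>r\<close>.
\<close>

lemma eikonal_correction:
  fixes s \<sigma> g g1 g2 r r1 r2 V :: real
  assumes "eikonal s V (1 + s * g) (s * g1) (s * g2) = s * \<sigma> * r"
  shows "eikonal s V (1 + s * (g - \<sigma> * r)) (s * (g1 - \<sigma> * r1)) (s * (g2 - \<sigma> * r2)) = s * s * \<sigma> *
    (\<sigma> * r\<^sup>2 * (2 + 3 * (s * g)) - r * (4 + 3 * (s * g)) * g - \<sigma>\<^sup>2 * s * r ^ 3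
     + V * (s * \<sigma> * r\<^sup>2 - 2 * ((1 + s * g) * r))
     + (1 / 4) * (s * \<sigma> * (r * r2) - s * g2 * r - (1 + s * g) * r2)
     + (5 / 16) * (2 * (s * g1 * r1) - s * \<sigma> * r1\<^sup>2))" (is "?N = s * s * \<sigma> * ?R")
proof -
  have "?N = eikonal s V (1 + s * g) (s * g1) (s * g2) - s * \<sigma> * r + s * s * \<sigma> * ?R"
    unfolding eikonal_def by (simp add: power2_eq_square power3_eq_cube field_simps)
  then show ?thesis using assms by simp
qed

text \<open>
  The family \<open>G = 1\<close> leaves the error \<open>s V\<close>; each correction gains one power of \<open>s\<close> and stays in the algebra of
  uniformly bounded families, which is closed under differentiation.
\<close>

lemma eikonal_solvable:
  assumes V: "symbol (\<lambda>s. V)"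
  shows "\<exists>g g1 g2 R. symbol g \<and> symbol g1 \<and> symbol g2 \<and> symbol R \<and>
    (\<forall>s x. (g s has_real_derivative g1 s x) (at x)) \<and> (\<forall>s x. (g1 s has_real_derivative g2 s x) (at x)) \<and>
    (\<forall>s x. eikonal s (V x) (1 + s * g s x) (s * g1 s x) (s * g2 s x) = s * s ^ K * R s x)"
proof (induction K)
  case 0
  show ?case
    by (rule exI[of _ "\<lambda>s x. 0"], rule exI[of _ "\<lambda>s x. 0"], rule exI[of _ "\<lambda>s x. 0"], rule exI[of _ "\<lambda>s. V"])
       (simp add: symbol_const V eikonal_def)
next
  case (Suc K)
  then obtain g g1 g2 r where sy: "symbol g" "symbol g1" "symbol g2" "symbol r"
    and d: "\<And>s x. (g s has_real_derivative g1 s x) (at x)" "\<And>s x. (g1 s has_real_derivative g2 s x) (at x)"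
    and e: "\<And>s x. eikonal s (V x) (1 + s * g s x) (s * g1 s x) (s * g2 s x) = s * s ^ K * r s x"
    by blast
  obtain r1 where r1: "\<And>s x. (r s has_real_derivative r1 s x) (at x)" "symbol r1" using symbol_deriv[OF sy(4)] by metis
  obtain r2 where r2: "\<And>s x. (r1 s has_real_derivative r2 s x) (at x)" "symbol r2" using symbol_deriv[OF r1(2)] by metis
  define R where "R s x = s ^ K * (r s x)\<^sup>2 * (2 + 3 * (s * g s x)) - r s x * (4 + 3 * (s * g s x)) * g s x - (s ^ K)\<^sup>2 * s * r s x ^ 3
     + V x * (s * s ^ K * (r s x)\<^sup>2 - 2 * ((1 + s * g s x) * r s x))
     + (1 / 4) * (s * s ^ K * (r s x * r2 s x) - s * g2 s x * r s x - (1 + s * g s x) * r2 s x)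
     + (5 / 16) * (2 * (s * g1 s x * r1 s x) - s * s ^ K * (r1 s x)\<^sup>2)" for s x
  have "symbol R" unfolding R_def[abs_def]
    by (intro symbol_add symbol_diff symbol_mult symbol_power symbol_const symbol_parameter symbol_parameter1 sy r1 r2 V)
  moreover have "symbol (\<lambda>s x. g s x - s ^ K * r s x)" "symbol (\<lambda>s x. g1 s x - s ^ K * r1 s x)" "symbol (\<lambda>s x. g2 s x - s ^ K * r2 s x)"
    by (intro symbol_diff symbol_mult symbol_parameter sy r1 r2)+
  moreover have "((\<lambda>x. g s x - s ^ K * r s x) has_real_derivative g1 s x - s ^ K * r1 s x) (at x)"
     "((\<lambda>x. g1 s x - s ^ K * r1 s x) has_real_derivative g2 s x - s ^ K * r2 s x) (at x)" for s x
    by (intro DERIV_diff DERIV_cmult d r1 r2)+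
  moreover have "eikonal s (V x) (1 + s * (g s x - s ^ K * r s x)) (s * (g1 s x - s ^ K * r1 s x)) (s * (g2 s x - s ^ K * r2 s x)) = s * s ^ Suc K * R s x" for s x
    using eikonal_correction[OF e, of s x "r1 s x" "r2 s x"] unfolding R_def[symmetric] by (simp add: mult.assoc)
  ultimately show ?case by blast
qed

text \<open>
  For \<open>s = 1 / E\<close> small, \<open>G = 1 + s g\<close> lies between \<open>1 / 2\<close> and \<open>3 / 2\<close>, so that dividing by
  \<open>s G\<^sup>2\<close> costs only a constant factor beyond the power of \<open>E\<close>.
\<close>

lemma approximate_phase:
  assumes V: "symbol (\<lambda>s. V)"
  shows "\<exists>\<Lambda> C. \<Lambda> \<ge> 1 \<and> C > 0 \<and> (\<forall>E \<ge> \<Lambda>. \<exists>P P' P'' B.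
       (\<forall>x. (P has_real_derivative P' x) (at x)) \<and> (\<forall>x. (P' has_real_derivative P'' x) (at x)) \<and>
       continuous_on UNIV P'' \<and>
       (\<forall>x. E / 2 \<le> P x \<and> P x \<le> 3 * E / 2 \<and> \<bar>P' x\<bar> \<le> B) \<and>
       (\<forall>x. \<bar>P x + P'' x / (4 * P x) - 5 * (P' x)\<^sup>2 / (16 * (P x)\<^sup>2) + V x - E\<bar> \<le> C * inverse E ^ K))"
proof -
  obtain g g1 g2 R where sy: "symbol g" "symbol g1" "symbol g2" "symbol R"
    and d: "\<And>s x. (g s has_real_derivative g1 s x) (at x)" "\<And>s x. (g1 s has_real_derivative g2 s x) (at x)"
    and e: "\<And>s x. eikonal s (V x) (1 + s * g s x) (s * g1 s x) (s * g2 s x) = s * s ^ K * R s x"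
    using eikonal_solvable[OF V, of K] by blast
  obtain g3 where g3: "\<And>s x. (g2 s has_real_derivative g3 s x) (at x)" using symbol_deriv[OF sy(3)] by metis
  obtain Cg where Cg: "\<And>s x. 0 < s \<Longrightarrow> s \<le> 1 \<Longrightarrow> \<bar>g s x\<bar> \<le> Cg" using symbol_bound[OF sy(1)] by metis
  obtain C1 where C1: "\<And>s x. 0 < s \<Longrightarrow> s \<le> 1 \<Longrightarrow> \<bar>g1 s x\<bar> \<le> C1" using symbol_bound[OF sy(2)] by metis
  obtain CR where CR: "\<And>s x. 0 < s \<Longrightarrow> s \<le> 1 \<Longrightarrow> \<bar>R s x\<bar> \<le> CR" using symbol_bound[OF sy(4)] by metis
  define \<Lambda> where "\<Lambda> = max 1 (2 * Cg)"
  define C where "C = 4 * \<bar>CR\<bar> + 1"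
  show ?thesis
  proof (rule exI[of _ \<Lambda>], rule exI[of _ C], intro conjI allI impI)
    show "\<Lambda> \<ge> 1" "C > 0" by (auto simp: \<Lambda>_def C_def)
    fix E assume E: "E \<ge> \<Lambda>"
    then have E1: "E \<ge> 1" "2 * Cg \<le> E" by (auto simp: \<Lambda>_def)
    define s where "s = inverse E"
    have s: "0 < s" "s \<le> 1" "E * s = 1" using E1 by (auto simp: s_def field_simps)
    define G where "G x = 1 + s * g s x" for x
    have G: "1 / 2 \<le> G x" "G x \<le> 3 / 2" for x
    proof -
      have "\<bar>s * g s x\<bar> \<le> s * Cg" using Cg[OF s(1,2)] s(1) by (simp add: abs_mult mult_left_mono)
      also have "\<dots> \<le> s * (E / 2)" using E1 s(1) by (intro mult_left_mono) auto
      also have "\<dots> = 1 / 2" using s(3) by (simp add: mult.commute)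
      finally show "1 / 2 \<le> G x" "G x \<le> 3 / 2" unfolding G_def by linarith+
    qed
    define P P' P'' where "P = (\<lambda>x. E * G x)" and "P' = (\<lambda>x. g1 s x)" and "P'' = (\<lambda>x. g2 s x)"
    have Pg: "P = (\<lambda>x. E + g s x)" using s(3) by (auto simp: P_def G_def algebra_simps simp flip: mult.assoc)
    have dP: "(P has_real_derivative P' x) (at x)" for x
      unfolding Pg P'_def using DERIV_add[OF DERIV_const d(1)] by simp
    have dP': "(P' has_real_derivative P'' x) (at x)" for x
      unfolding P'_def P''_def by (rule d(2))
    have cP: "continuous_on UNIV P''"
      unfolding P''_def by (intro continuous_at_imp_continuous_on ballI DERIV_isCont[OF g3])
    have bP: "E / 2 \<le> P x" "P x \<le> 3 * E / 2" "\<bar>P' x\<bar> \<le> C1" for x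
      using mult_left_mono[OF G(1)[of x], of E] mult_left_mono[OF G(2)[of x], of E] C1[OF s(1,2)] E1
      by (auto simp: P_def P'_def)
    have res: "\<bar>P x + P'' x / (4 * P x) - 5 * (P' x)\<^sup>2 / (16 * (P x)\<^sup>2) + V x - E\<bar> \<le> C * inverse E ^ K" for x
    proof -
      have G0: "G x \<noteq> 0" "G x > 0" using G(1)[of x] by auto
      have "E \<noteq> 0" using E1 by simp
      have eq: "P x + P'' x / (4 * P x) - 5 * (P' x)\<^sup>2 / (16 * (P x)\<^sup>2) + V x - E
          = E * eikonal s (V x) (G x) (s * g1 s x) (s * g2 s x) / (G x)\<^sup>2"
        unfolding eikonal_def P_def P'_def P''_def s_def using G0 \<open>E \<noteq> 0\<close>
        by (simp add: field_simps power2_eq_square power3_eq_cube)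
      also have "\<dots> = s ^ K * R s x / (G x)\<^sup>2"
        unfolding G_def e using s(3) by (simp add: mult.assoc[symmetric])
      finally have "P x + P'' x / (4 * P x) - 5 * (P' x)\<^sup>2 / (16 * (P x)\<^sup>2) + V x - E = s ^ K * R s x / (G x)\<^sup>2" .
      moreover have "\<bar>s ^ K * R s x / (G x)\<^sup>2\<bar> \<le> C * s ^ K"
      proof -
        have "(1 / 2)\<^sup>2 \<le> (G x)\<^sup>2" using G(1)[of x] by (intro power_mono) auto
        then have "inverse ((G x)\<^sup>2) \<le> 4" using G0 by (simp add: field_simps power2_eq_square)
        moreover have "\<bar>R s x\<bar> \<le> \<bar>CR\<bar>" using CR[OF s(1,2), of x] by linarith
        ultimately have "\<bar>R s x\<bar> * inverse ((G x)\<^sup>2) \<le> \<bar>CR\<bar> * 4" by (intro mult_mono) auto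
        then have "\<bar>R s x\<bar> * inverse ((G x)\<^sup>2) \<le> C" unfolding C_def by linarith
        then have "s ^ K * (\<bar>R s x\<bar> * inverse ((G x)\<^sup>2)) \<le> s ^ K * C" using s(1) by (intro mult_left_mono) auto
        then show ?thesis using s(1) by (simp add: abs_mult divide_inverse mult_ac)
      qed
      ultimately show ?thesis by (simp add: s_def)
    qed
    show "\<exists>P P' P'' B.
       (\<forall>x. (P has_real_derivative P' x) (at x)) \<and> (\<forall>x. (P' has_real_derivative P'' x) (at x)) \<and>
       continuous_on UNIV P'' \<and>
       (\<forall>x. E / 2 \<le> P x \<and> P x \<le> 3 * E / 2 \<and> \<bar>P' x\<bar> \<le> B) \<and>
       (\<forall>x. \<bar>P x + P'' x / (4 * P x) - 5 * (P' x)\<^sup>2 / (16 * (P x)\<^sup>2) + V x - E\<bar> \<le> C * inverse E ^ K)"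
      using dP dP' cP bP res by blast
  qed
qed

section \<open>Oscillating approximate solutions\<close>

text \<open>
  With \<open>u = exp z\<close> and \<open>w = z' = q + i (p - b)\<close>, the equation becomes the Riccati expression
  \<open>- (w' + w\<^sup>2) - i a\<^sub>1 w + a\<^sub>0 - E\<close>. The choices \<open>p = \<surd>P\<close> and \<open>q = - P' / (4 P)\<close>, that is, the amplitude
  \<open>P\<^sup>-\<^sup>1\<^sup>/\<^sup>4\<close>, make its imaginary part vanish, and \<open>p - b\<close> instead of \<open>p\<close> absorbs the first-order term. Boundedness of
  \<open>P\<close> from both sides gives that of \<open>\<bar>u\<bar>\<close>.
\<close>

lemma wkb_solution:
  fixes P P' P'' :: "real \<Rightarrow> real"
  assumes Q: "(a1, a0) \<in> Diff1" and sa: "formally_self_adjoint (a1, a0)"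
    and dP: "\<And>x. (P has_real_derivative P' x) (at x)" and dP': "\<And>x. (P' has_real_derivative P'' x) (at x)"
    and cP'': "continuous_on UNIV P''"
    and m: "m > 0" "\<And>x. m \<le> P x" and M: "\<And>x. P x \<le> M" and B: "\<And>x. \<bar>P' x\<bar> \<le> B"
  shows "\<exists>u u' u'' c1 c2 c3.
    (\<forall>x. (u has_vector_derivative u' x) (at x)) \<and> (\<forall>x. (u' has_vector_derivative u'' x) (at x)) \<and>
    continuous_on UNIV u'' \<and> c1 > 0 \<and>
    (\<forall>x. c1 \<le> cmod (u x) \<and> cmod (u x) \<le> c2 \<and> cmod (u' x) \<le> c3) \<and>
    (\<forall>x. - u'' x + app_op (a1, a0) u u' x - complex_of_real E * u x =
      complex_of_real (P x + P'' x / (4 * P x) - 5 * (P' x)\<^sup>2 / (16 * (P x)\<^sup>2) + (Re (a0 x) - (Re (a1 x) / 2)\<^sup>2) - E) * u x)"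
proof -
  note sm = Diff1_smooth[OF Q]
  note co = formally_self_adjoint_coefficients[OF sm sa]
  have P0: "P x > 0" for x using m(2)[of x] m(1) by linarith
  define b b' where "b x = Re (a1 x) / 2" and "b' x = Re (vderiv a1 x) / 2" for x
  have a1: "a1 x = complex_of_real (2 * b x)" for x
    using co(1)[of x] by (simp add: complex_eq_iff b_def)
  have "vderiv a1 x = cnj (vderiv a1 x)" for x
    using smooth_cnj(2)[OF sm(1)] unfolding co(1) by metis
  then have "Im (vderiv a1 x) = 0" for x by (simp add: complex_eq_iff)
  then have a0: "a0 x = complex_of_real (Re (a0 x)) - \<i> * complex_of_real (b' x)" for x
    using co(2)[of x] by (simp add: complex_eq_iff b'_def)
  have db: "(b has_real_derivative b' x) (at x)" for x
  proof -
    have "((\<lambda>x. Re (a1 x)) has_real_derivative Re (vderiv a1 x)) (at x)"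
      unfolding has_real_derivative_iff_has_vector_derivative
      by (rule bounded_linear.has_vector_derivative[OF bounded_linear_Re smooth_has_vderiv[OF sm(1)]])
    from DERIV_cdivide[OF this, of 2] show ?thesis unfolding b_def b'_def .
  qed
  have cb': "continuous_on UNIV b'"
    unfolding b'_def[abs_def] by (intro continuous_on_divide continuous_on_Re continuous_on_const smooth_continuous smooth_vderiv sm) simp
  have cP: "continuous_on UNIV P" "continuous_on UNIV P'" "continuous_on UNIV b"
    by (intro continuous_at_imp_continuous_on ballI DERIV_isCont[OF dP] DERIV_isCont[OF dP'] DERIV_isCont[OF db])+
  define p where "p x = sqrt (P x)" for x
  have p0: "p x > 0" and p2: "p x * p x = P x" for x using P0[of x] by (simp_all add: p_def)
  have dp: "(p has_real_derivative P' x / (2 * p x)) (at x)" for x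
    unfolding p_def[abs_def] using P0[of x] dP[of x] by (auto intro!: derivative_eq_intros simp: field_simps)
  have cp: "continuous_on UNIV p"
    by (intro continuous_at_imp_continuous_on ballI DERIV_isCont[OF dp])
  obtain \<theta> where \<theta>: "\<And>x. (\<theta> has_vector_derivative p x - b x) (at x)"
    using continuous_antiderivative[OF continuous_on_diff[OF cp cP(3)]] by metis
  define q q' where "q x = - (P' x / (4 * P x))" and "q' x = - (P'' x / (4 * P x) - (P' x)\<^sup>2 / (4 * (P x)\<^sup>2))" for x
  have dl: "((\<lambda>x. - (ln (P x) / 4)) has_real_derivative q x) (at x)" for x
    unfolding q_def using P0[of x] dP[of x] by (auto intro!: derivative_eq_intros simp: field_simps)
  have dq: "(q has_real_derivative q' x) (at x)" for x
    unfolding q_def[abs_def] q'_def using P0[of x] dP[of x] dP'[of x]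
    by (auto intro!: derivative_eq_intros simp: field_simps power2_eq_square)
  define z where "z x = complex_of_real (- (ln (P x) / 4)) + \<i> * complex_of_real (\<theta> x)" for x
  define w where "w x = complex_of_real (q x) + \<i> * complex_of_real (p x - b x)" for x
  define w' where "w' x = complex_of_real (q' x) + \<i> * complex_of_real (P' x / (2 * p x) - b' x)" for x
  have of_real_vd: "((\<lambda>x. complex_of_real (f x)) has_vector_derivative complex_of_real D) (at x)"
    if "(f has_real_derivative D) (at x)" for f D x
    using that by (rule has_vector_derivative_of_real)
  have \<theta>': "(\<theta> has_real_derivative p x - b x) (at x)" for x
    using \<theta> by (simp add: has_real_derivative_iff_has_vector_derivative)
  have dz: "(z has_vector_derivative w x) (at x)" for x
    unfolding z_def[abs_def] w_def
    by (intro has_vector_derivative_add has_vector_derivative_mult_right of_real_vd dl \<theta>')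
  have dw: "(w has_vector_derivative w' x) (at x)" for x
    unfolding w_def[abs_def] w'_def
    by (intro has_vector_derivative_add has_vector_derivative_mult_right of_real_vd dq DERIV_diff dp db)
  define u where "u x = exp (z x)" for x
  have du: "(u has_vector_derivative w x * u x) (at x)" for x
    unfolding u_def[abs_def] using field_vector_diff_chain_at[OF dz DERIV_exp, of x] by (simp add: o_def)
  have ddu: "((\<lambda>x. w x * u x) has_vector_derivative (w' x + w x * w x) * u x) (at x)" for x
    using has_vector_derivative_mult[OF dw du, of x] by (simp add: algebra_simps)
  have cont: "continuous_on UNIV (\<lambda>x. (w' x + w x * w x) * u x)"
  proof -
    have nz: "P x \<noteq> 0" "p x \<noteq> 0" for x using P0[of x] p0[of x] by simp_all
    have "continuous_on UNIV u" "continuous_on UNIV w"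
      by (meson continuous_at_imp_continuous_on has_vector_derivative_continuous du dw)+
    moreover have "continuous_on UNIV w'"
    proof -
      have "continuous_on UNIV q'"
        unfolding q'_def by (intro continuous_on_minus continuous_on_diff continuous_on_divide continuous_on_mult
            continuous_on_power continuous_on_const cP cP'') (simp_all add: nz)
      moreover have "continuous_on UNIV (\<lambda>x. P' x / (2 * p x) - b' x)"
        by (intro continuous_on_diff continuous_on_divide continuous_on_mult continuous_on_const cP cp cb') (simp_all add: nz)
      ultimately show ?thesis unfolding w'_def[abs_def]
        by (intro continuous_on_add continuous_on_mult continuous_on_const continuous_on_of_real)
    qed
    ultimately show ?thesis by (intro continuous_intros)
  qed
  have nu: "cmod (u x) = exp (- (ln (P x) / 4))" for x by (simp add: u_def z_def)
  have lo: "exp (- (ln M / 4)) \<le> cmod (u x)" for x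
    unfolding nu using M[of x] P0[of x] by simp
  have hi: "cmod (u x) \<le> exp (- (ln m / 4))" for x
    unfolding nu using m(2)[of x] m(1) by simp
  obtain Ba where Ba: "\<And>x. cmod (a1 x) \<le> Ba" using Diff1_bounded[OF Q] by metis
  have wB: "cmod (w x) \<le> B / (4 * m) + (sqrt M + Ba)" for x
  proof -
    have "\<bar>q x\<bar> = \<bar>P' x\<bar> / (4 * P x)" using P0[of x] by (simp add: q_def abs_div abs_mult)
    also have "\<dots> \<le> B / (4 * m)"
      using m(1) m(2)[of x] B[of x] by (intro frac_le) auto
    finally have 1: "\<bar>q x\<bar> \<le> B / (4 * m)" .
    have "\<bar>p x\<bar> \<le> sqrt M" using M[of x] P0[of x] by (simp add: p_def)
    moreover have "\<bar>b x\<bar> \<le> Ba" using Ba[of x] unfolding a1 norm_of_real by simp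
    ultimately have 2: "\<bar>p x - b x\<bar> \<le> sqrt M + Ba" by linarith
    have "cmod (w x) \<le> \<bar>q x\<bar> + \<bar>p x - b x\<bar>"
      unfolding w_def by (rule order_trans[OF norm_triangle_ineq]) (simp add: norm_mult flip: of_real_diff)
    then show ?thesis using 1 2 by linarith
  qed
  have u'B: "cmod (w x * u x) \<le> (B / (4 * m) + (sqrt M + Ba)) * exp (- (ln m / 4))" for x
    unfolding norm_mult by (intro mult_mono wB hi order_trans[OF norm_ge_zero wB[of x]] norm_ge_zero)
  have eq: "- ((w' x + w x * w x) * u x) + app_op (a1, a0) u (\<lambda>x. w x * u x) x - complex_of_real E * u x =
      complex_of_real (P x + P'' x / (4 * P x) - 5 * (P' x)\<^sup>2 / (16 * (P x)\<^sup>2) + (Re (a0 x) - (Re (a1 x) / 2)\<^sup>2) - E) * u x" for x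
  proof -
    define r where "r = P x + P'' x / (4 * P x) - 5 * (P' x)\<^sup>2 / (16 * (P x)\<^sup>2) + (Re (a0 x) - (Re (a1 x) / 2)\<^sup>2) - E"
    have 1: "P' x / (2 * p x) + 2 * (p x * q x) = 0"
      unfolding q_def p2[symmetric] using p0[of x] by (simp add: field_simps)
    have 2: "- q' x - q x * q x = P'' x / (4 * P x) - 5 * (P' x)\<^sup>2 / (16 * (P x)\<^sup>2)"
      unfolding q_def q'_def using P0[of x] by (simp add: field_simps power2_eq_square)
    have "- (w' x + w x * w x) - \<i> * (a1 x * w x) + a0 x - complex_of_real E = complex_of_real r"
    proof (rule complex_eqI)
      have "Re (- (w' x + w x * w x) - \<i> * (a1 x * w x) + a0 x - complex_of_real E)
        = (- q' x - q x * q x) + p x * p x + (Re (a0 x) - b x * b x) - E"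
        unfolding w_def w'_def a1 by (simp add: algebra_simps)
      also have "\<dots> = r" unfolding 2 p2 r_def b_def by (simp add: power2_eq_square)
      finally show "Re (- (w' x + w x * w x) - \<i> * (a1 x * w x) + a0 x - complex_of_real E) = Re (complex_of_real r)" by simp
      have "Im (a0 x) = - b' x" by (subst a0) simp
      then have "Im (- (w' x + w x * w x) - \<i> * (a1 x * w x) + a0 x - complex_of_real E)
        = - (P' x / (2 * p x) + 2 * (p x * q x))"
        unfolding w_def w'_def a1 by (simp add: algebra_simps)
      then show "Im (- (w' x + w x * w x) - \<i> * (a1 x * w x) + a0 x - complex_of_real E) = Im (complex_of_real r)"
        unfolding 1 by simp
    qed
    then have "(- (w' x + w x * w x) - \<i> * (a1 x * w x) + a0 x - complex_of_real E) * u x = complex_of_real r * u x" by simp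
    then show ?thesis unfolding r_def app_op_def fst_conv snd_conv by (simp add: algebra_simps)
  qed
  show ?thesis
    by (rule exI[of _ u], rule exI[of _ "\<lambda>x. w x * u x"], rule exI[of _ "\<lambda>x. (w' x + w x * w x) * u x"],
        rule exI[of _ "exp (- (ln M / 4))"], rule exI[of _ "exp (- (ln m / 4))"],
        rule exI[of _ "(B / (4 * m) + (sqrt M + Ba)) * exp (- (ln m / 4))"],
        intro conjI allI du ddu cont lo hi u'B eq exp_gt_zero)
qed

section \<open>Cutting off approximate solutions\<close>

text \<open>
  Let \<open>k\<close> be the cutoff at scale \<open>R\<close>. In \<open>(H - E) (k u) = k (H - E) u + e\<close> the commutator term \<open>e\<close> is \<open>O(1 / R)\<close> on an
  interval of length \<open>4 R\<close>, so its squared norm is \<open>O(1 / R)\<close>, while \<open>k u\<close> has squared norm at least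
  \<open>2 R c1\<^sup>2\<close>. Large \<open>R\<close> leaves only the residual \<open>\<eta>\<close>.
\<close>

lemma quasimode_bound:
  assumes Q: "(a1, a0) \<in> Diff1"
    and u: "\<And>x. (u has_vector_derivative u' x) (at x)" and u': "\<And>x. (u' has_vector_derivative u'' x) (at x)"
    and cu'': "continuous_on UNIV u''"
    and c1: "c1 > 0" "\<And>x. c1 \<le> cmod (u x)" and c2: "\<And>x. cmod (u x) \<le> c2" and c3: "\<And>x. cmod (u' x) \<le> c3"
    and res: "\<And>x. cmod (- u'' x + app_op (a1, a0) u u' x - complex_of_real E * u x) \<le> \<eta> * cmod (u x)"
    and low: "\<And>\<phi> f. (\<phi>, f) \<in> H_op (a1, a0) \<Longrightarrow> d * sqint \<phi> \<le> sqint (\<lambda>x. f x - complex_of_real E * \<phi> x)"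
  shows "d \<le> 2 * \<eta>\<^sup>2"
proof (rule ccontr)
  assume "\<not> d \<le> 2 * \<eta>\<^sup>2"
  then have gap: "d - 2 * \<eta>\<^sup>2 > 0" by simp
  obtain Ba where Ba: "\<And>x. cmod (a1 x) \<le> Ba" using Diff1_bounded[OF Q] by metis
  obtain B1 where B1: "B1 > 0" "\<And>x. cmod (vderiv cutoff x) \<le> B1"
    using test_fun_bounded[OF test_fun_vderiv[OF cutoff_test]] by metis
  obtain B2 where B2: "B2 > 0" "\<And>x. cmod (vderiv (vderiv cutoff) x) \<le> B2"
    using test_fun_bounded[OF test_fun_vderiv[OF test_fun_vderiv[OF cutoff_test]]] by metis
  have nn: "0 \<le> c2" "0 \<le> c3" "0 \<le> Ba"
    using order_trans[OF norm_ge_zero c2] order_trans[OF norm_ge_zero c3] order_trans[OF norm_ge_zero Ba] by auto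
  define D where "D = B2 * c2 + 2 * (B1 * c3) + Ba * (B1 * c2)"
  have D0: "D \<ge> 0" unfolding D_def using nn B1(1) B2(1) by simp
  have main: "(d - 2 * \<eta>\<^sup>2) * c1\<^sup>2 * R\<^sup>2 \<le> 4 * D\<^sup>2" if R: "R \<ge> 1" for R
  proof -
    define k where "k = dilated_cutoff R"
    define k1 where "k1 = vderiv k"
    define k2 where "k2 = vderiv k1"
    have R0: "R > 0" using R by simp
    have sk: "smooth k" "smooth k1" unfolding k1_def k_def by (intro dilated_cutoff_smooth smooth_vderiv)+
    have tk: "test_fun k" unfolding k_def by (rule dilated_cutoff_test[OF R0])
    have dk: "(k has_vector_derivative k1 x) (at x)" "(k1 has_vector_derivative k2 x) (at x)" for x
      unfolding k1_def k2_def using smooth_has_vderiv sk unfolding k1_def by blast+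
    have kz: "k x = 0" "k1 x = 0" "k2 x = 0" if "\<bar>x\<bar> > 2 * R" for x
    proof -
      have o: "open {x::real. \<bar>x\<bar> > 2 * R}" by (intro open_Collect_less continuous_intros)
      have 0: "k y = 0" if "\<bar>y\<bar> > 2 * R" for y unfolding k_def by (rule dilated_cutoff_eq_0[OF R0]) (use that in simp)
      have 1: "k1 y = 0" if "\<bar>y\<bar> > 2 * R" for y
        unfolding k1_def by (rule vderiv_eq_0_locally_const[OF o, where c=0]) (use that 0 in auto)
      have 2: "k2 y = 0" if "\<bar>y\<bar> > 2 * R" for y
        unfolding k2_def by (rule vderiv_eq_0_locally_const[OF o, where c=0]) (use that 1 in auto)
      show "k x = 0" "k1 x = 0" "k2 x = 0" using 0 1 2 that by auto
    qed
    have k1B: "cmod (k1 x) \<le> B1 / R" for x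
      unfolding k1_def k_def vderiv_dilated_cutoff norm_mult norm_of_real
      using B1(2)[of "inverse R * x"] R0 by (simp add: divide_inverse mult.commute mult_left_mono)
    have k2B: "cmod (k2 x) \<le> B2 / R" for x
    proof -
      have "cmod (k2 x) = inverse R * inverse R * cmod (vderiv (vderiv cutoff) (inverse R * x))"
        unfolding k2_def k1_def k_def vderiv2_dilated_cutoff norm_mult norm_of_real using R0 by simp
      also have "\<dots> \<le> (1 * inverse R) * B2"
        using R R0 B2 by (intro mult_mono) (auto simp: field_simps)
      finally show ?thesis by (simp add: divide_inverse mult.commute)
    qed
    define \<phi> where "\<phi> x = k x * u x" for x
    define \<phi>1 where "\<phi>1 x = k x * u' x + k1 x * u x" for x
    define \<phi>2 where "\<phi>2 x = (k x * u'' x + k1 x * u' x) + (k1 x * u' x + k2 x * u x)" for x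
    define f where "f x = - \<phi>2 x + app_op (a1, a0) \<phi> \<phi>1 x" for x
    have cu: "continuous_on UNIV u" "continuous_on UNIV u'"
      by (meson continuous_at_imp_continuous_on has_vector_derivative_continuous u u')+
    have mem: "(\<phi>, f) \<in> H_op (a1, a0)"
      unfolding f_def[abs_def]
    proof (rule H_op_classicalI[OF _ _ _ Q, where L="2 * R"])
      show "(\<phi> has_vector_derivative \<phi>1 x) (at x)" for x
        unfolding \<phi>_def[abs_def] \<phi>1_def by (intro has_vector_derivative_mult dk u)
      show "(\<phi>1 has_vector_derivative \<phi>2 x) (at x)" for x
        unfolding \<phi>1_def[abs_def] \<phi>2_def by (intro has_vector_derivative_add has_vector_derivative_mult dk u u')
      show "continuous_on UNIV \<phi>2"
        unfolding \<phi>2_def[abs_def] k2_def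
        by (intro continuous_intros cu cu'' smooth_continuous sk smooth_vderiv)
    qed (simp_all add: \<phi>_def \<phi>1_def \<phi>2_def kz)
    have L2: "\<phi> \<in> L2" "f \<in> L2" using H_op_in_L2[OF mem] by auto
    define \<rho> where "\<rho> x = k x * (- u'' x + app_op (a1, a0) u u' x - complex_of_real E * u x)" for x
    define e where "e x = - (k2 x * u x) - 2 * (k1 x * u' x) - \<i> * (a1 x * (k1 x * u x))" for x
    have split: "f x - complex_of_real E * \<phi> x = \<rho> x + e x" for x
      unfolding f_def \<phi>_def \<phi>1_def \<phi>2_def \<rho>_def e_def app_op_def fst_conv snd_conv by (simp add: algebra_simps)
    have fE: "(\<lambda>x. f x - complex_of_real E * \<phi> x) \<in> L2" by (intro L2_diff L2_cmult L2)
    have ma [measurable]: "a1 \<in> borel_measurable borel" "a0 \<in> borel_measurable borel" "k \<in> borel_measurable borel"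
        "k1 \<in> borel_measurable borel" "k2 \<in> borel_measurable borel" "u \<in> borel_measurable borel"
        "u' \<in> borel_measurable borel" "u'' \<in> borel_measurable borel"
      unfolding k2_def by (intro borel_measurable_continuous_onI smooth_continuous smooth_vderiv sk Diff1_smooth[OF Q] cu cu'')+
    have eB: "cmod (e x) \<le> D / R * indicator {-2*R..2*R} x" for x
    proof (cases "\<bar>x\<bar> > 2 * R")
      case True
      then have "e x = 0" by (simp add: e_def kz)
      then show ?thesis using D0 R0 by (simp add: indicator_def)
    next
      case False
      then have i: "indicator {-2*R..2*R} x = (1::real)" by (auto simp: indicator_def)
      have "cmod (e x) \<le> cmod (k2 x) * cmod (u x) + 2 * (cmod (k1 x) * cmod (u' x)) + cmod (a1 x) * (cmod (k1 x) * cmod (u x))"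
        unfolding e_def
        by (rule order_trans[OF norm_triangle_ineq4], intro add_mono order_trans[OF norm_triangle_ineq4])
           (simp_all add: norm_mult)
      also have "\<dots> \<le> (B2 / R) * c2 + 2 * ((B1 / R) * c3) + Ba * ((B1 / R) * c2)"
        using k2B k1B c2 c3 Ba nn R0 B1(1) B2(1) by (intro add_mono mult_mono) auto
      also have "\<dots> = D / R" unfolding D_def by (simp add: add_divide_distrib mult_ac)
      finally show ?thesis unfolding i by simp
    qed
    have \<rho>B: "cmod (\<rho> x) \<le> \<bar>\<eta>\<bar> * cmod (\<phi> x)" for x
    proof -
      have "\<eta> * cmod (u x) \<le> \<bar>\<eta>\<bar> * cmod (u x)" by (intro mult_right_mono) auto
      then have "cmod (- u'' x + app_op (a1, a0) u u' x - complex_of_real E * u x) \<le> \<bar>\<eta>\<bar> * cmod (u x)"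
        using res[of x] by linarith
      then have "cmod (k x) * cmod (- u'' x + app_op (a1, a0) u u' x - complex_of_real E * u x) \<le> cmod (k x) * (\<bar>\<eta>\<bar> * cmod (u x))"
        by (rule mult_left_mono) simp
      then show ?thesis unfolding \<rho>_def \<phi>_def norm_mult by (simp add: mult_ac)
    qed
    have ind: "integrable lborel (\<lambda>x. (r::real) * indicator {a..b} x)"
      "(LINT x|lborel. r * indicator {a..b} x) = r * (b - a)" if "a \<le> b" for a b r :: real
      using that by simp_all
    have upper: "sqint (\<lambda>x. f x - complex_of_real E * \<phi> x) \<le> 2 * \<eta>\<^sup>2 * sqint \<phi> + 8 * D\<^sup>2 / R"
    proof -
      have "sqint (\<lambda>x. f x - complex_of_real E * \<phi> x)
        \<le> (LINT x|lborel. 2 * \<eta>\<^sup>2 * (cmod (\<phi> x))\<^sup>2 + 2 * (D / R)\<^sup>2 * indicator {-2*R..2*R} x)"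
        unfolding sqint_def
      proof (rule integral_mono)
        show "integrable lborel (\<lambda>x. (cmod (f x - complex_of_real E * \<phi> x))\<^sup>2)" using fE by (simp add: L2_def)
        show "integrable lborel (\<lambda>x. 2 * \<eta>\<^sup>2 * (cmod (\<phi> x))\<^sup>2 + 2 * (D / R)\<^sup>2 * indicator {-2*R..2*R} x)"
          using L2(1) R0 by (intro Bochner_Integration.integrable_add integrable_mult_right ind) (auto simp: L2_def)
        fix x
        have "(cmod (f x - complex_of_real E * \<phi> x))\<^sup>2 \<le> 2 * (cmod (\<rho> x))\<^sup>2 + 2 * (cmod (e x))\<^sup>2"
          unfolding split by (rule cmod_add_sq_le)
        also have "\<dots> \<le> 2 * (\<bar>\<eta>\<bar> * cmod (\<phi> x))\<^sup>2 + 2 * (D / R * indicator {-2*R..2*R} x)\<^sup>2"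
          using \<rho>B[of x] eB[of x] by (intro add_mono mult_left_mono power_mono) auto
        also have "\<dots> = 2 * \<eta>\<^sup>2 * (cmod (\<phi> x))\<^sup>2 + 2 * (D / R)\<^sup>2 * indicator {-2*R..2*R} x"
          by (simp add: power_mult_distrib indicator_def)
        finally show "(cmod (f x - complex_of_real E * \<phi> x))\<^sup>2 \<le> 2 * \<eta>\<^sup>2 * (cmod (\<phi> x))\<^sup>2 + 2 * (D / R)\<^sup>2 * indicator {-2*R..2*R} x" .
      qed
      also have "\<dots> = (LINT x|lborel. 2 * \<eta>\<^sup>2 * (cmod (\<phi> x))\<^sup>2) + (LINT x|lborel. 2 * (D / R)\<^sup>2 * indicator {-2*R..2*R} x)"
        using L2(1) R0 by (intro Bochner_Integration.integral_add integrable_mult_right ind) (auto simp: L2_def)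
      also have "(LINT x|lborel. 2 * (D / R)\<^sup>2 * indicator {-2*R..2*R} x) = 2 * (D / R)\<^sup>2 * (2 * R - (- 2 * R))"
        by (rule ind) (use R0 in simp)
      also have "\<dots> = 8 * D\<^sup>2 / R" using R0 by (simp add: field_simps power2_eq_square)
      finally show ?thesis by (simp add: sqint_def)
    qed
    have lower: "c1\<^sup>2 * (2 * R) \<le> sqint \<phi>"
    proof -
      have "(LINT x|lborel. c1\<^sup>2 * indicator {-R..R} x) \<le> sqint \<phi>"
        unfolding sqint_def
      proof (rule integral_mono)
        show "integrable lborel (\<lambda>x. c1\<^sup>2 * indicator {-R..R} x)" by (rule ind) (use R0 in simp)
        show "integrable lborel (\<lambda>x. (cmod (\<phi> x))\<^sup>2)" using L2 by (simp add: L2_def)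
        fix x
        show "c1\<^sup>2 * indicator {-R..R} x \<le> (cmod (\<phi> x))\<^sup>2"
        proof (cases "\<bar>x\<bar> \<le> R")
          case True
          then have "\<phi> x = u x" unfolding \<phi>_def k_def using dilated_cutoff_eq_1[OF R0] by simp
          then have "c1\<^sup>2 \<le> (cmod (\<phi> x))\<^sup>2" using c1 by (simp add: power_mono)
          then show ?thesis by (simp add: indicator_def)
        qed (auto simp: indicator_def)
      qed
      moreover have "(LINT x|lborel. c1\<^sup>2 * indicator {-R..R} x) = c1\<^sup>2 * (R - - R)"
        by (rule ind) (use R0 in simp)
      ultimately have "c1\<^sup>2 * (R - - R) \<le> sqint \<phi>" by linarith
      then show ?thesis by simp
    qed
    have "(d - 2 * \<eta>\<^sup>2) * (c1\<^sup>2 * (2 * R)) \<le> (d - 2 * \<eta>\<^sup>2) * sqint \<phi>"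
      using gap lower by (intro mult_left_mono) auto
    also have "\<dots> \<le> 8 * D\<^sup>2 / R" using low[OF mem] upper by (simp add: algebra_simps)
    finally show ?thesis using R0 by (simp add: field_simps power2_eq_square)
  qed
  \<comment> \<open>large enough to violate the bound \<open>main\<close>\<close>
  define R where "R = 1 + 4 * D\<^sup>2 / ((d - 2 * \<eta>\<^sup>2) * c1\<^sup>2)"
  have den: "(d - 2 * \<eta>\<^sup>2) * c1\<^sup>2 > 0" using gap c1(1) by simp
  have R1: "R \<ge> 1" unfolding R_def using den by simp
  have "(d - 2 * \<eta>\<^sup>2) * c1\<^sup>2 * R \<le> (d - 2 * \<eta>\<^sup>2) * c1\<^sup>2 * R\<^sup>2"
    using den R1 by (intro mult_left_mono) (auto simp: power2_eq_square)
  also have "\<dots> \<le> 4 * D\<^sup>2" by (rule main[OF R1])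
  also have "4 * D\<^sup>2 < (d - 2 * \<eta>\<^sup>2) * c1\<^sup>2 * R"
    unfolding R_def using den gap c1 by (simp add: distrib_left)
  finally show False by simp
qed

section \<open>Superpolynomial decay of spectral gaps\<close>

theorem corollary1p18:
  fixes Q :: diff_op1
  assumes "Q \<in> Diff1"
    and "formally_self_adjoint Q"
  shows "\<forall>N::real. N > 0 \<longrightarrow> (\<exists>C::real. C > 0 \<and> (\<forall>\<rho> \<epsilon> :: real. \<rho> > 1 \<longrightarrow>
           spectral_gap (H_op Q) {\<rho>\<^sup>2 .. \<rho>\<^sup>2 + \<epsilon>} \<longrightarrow> \<epsilon> < C * \<rho> powr (- N)))"
proof (intro allI impI)
  fix N :: real assume N: "N > 0"
  obtain a1 a0 where Qeq: "Q = (a1, a0)" by fastforce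
  note Q = assms(1)[unfolded Qeq] and sa = assms(2)[unfolded Qeq]
  obtain K :: nat where K: "N \<le> real K" using real_arch_simple by blast
  have bd: "bounded (range ((vderiv ^^ n) a1))" "bounded (range ((vderiv ^^ n) a0))" for n
    using Q unfolding Diff1_def by auto
  define V where "V x = Re (a0 x) - (Re (a1 x) / 2)\<^sup>2" for x
  have "symbol (\<lambda>s x. Re (a0 x) - ((1 / 2) * Re (a1 x)) ^ 2)"
    by (intro symbol_diff symbol_power symbol_mult symbol_const symbol_Re Diff1_smooth[OF Q] bd)
  then have "symbol (\<lambda>s. V)" by (simp add: V_def[abs_def])
  from approximate_phase[OF this, of K]
  obtain \<Lambda> C where \<Lambda>: "\<Lambda> \<ge> 1" and C: "C > 0" and ph:
    "\<And>E. E \<ge> \<Lambda> \<Longrightarrow> \<exists>P P' P'' B.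
       (\<forall>x. (P has_real_derivative P' x) (at x)) \<and> (\<forall>x. (P' has_real_derivative P'' x) (at x)) \<and>
       continuous_on UNIV P'' \<and>
       (\<forall>x. E / 2 \<le> P x \<and> P x \<le> 3 * E / 2 \<and> \<bar>P' x\<bar> \<le> B) \<and>
       (\<forall>x. \<bar>P x + P'' x / (4 * P x) - 5 * (P' x)\<^sup>2 / (16 * (P x)\<^sup>2) + V x - E\<bar> \<le> C * inverse E ^ K)"
    by blast
  \<comment> \<open>The second summand covers gaps with midpoint below \<open>\<Lambda>\<close>, for which \<open>\<epsilon> < 2 \<Lambda>\<close> and \<open>\<rho> \<le> \<Lambda>\<close>.\<close>
  define C' where "C' = 4 * C + 2 * \<Lambda> * \<Lambda> powr N"
  have C': "C' > 0" unfolding C'_def using C \<Lambda> by (intro add_pos_nonneg) auto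
  have "\<epsilon> < C' * \<rho> powr (- N)" if \<rho>: "\<rho> > 1" and gap: "spectral_gap (H_op Q) {\<rho>\<^sup>2 .. \<rho>\<^sup>2 + \<epsilon>}" for \<rho> \<epsilon> :: real
  proof (cases "\<epsilon> \<le> 0")
    case True
    have "C' * \<rho> powr (- N) > 0" using C' \<rho> by simp
    then show ?thesis using True by linarith
  next
    case False
    \<comment> \<open>the midpoint and the half-length of the gap\<close>
    define E \<delta> where "E = \<rho>\<^sup>2 + \<epsilon> / 2" and "\<delta> = \<epsilon> / 2"
    have \<delta>: "\<delta> > 0" using False by (simp add: \<delta>_def)
    have \<rho>2: "\<rho> < \<rho>\<^sup>2" using \<rho> by (simp add: power2_eq_square)
    have pw: "\<rho> powr (- N) > 0" using \<rho> by simp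
    have res: "complex_of_real z \<in> resolvent_set (H_op Q)" if "E - \<delta> < z" "z < E + \<delta>" for z
    proof -
      have "z \<in> interior {\<rho>\<^sup>2 .. \<rho>\<^sup>2 + \<epsilon>}" using that by (simp add: E_def \<delta>_def)
      then show ?thesis using gap unfolding spectral_gap_def spectrum_def by blast
    qed
    show ?thesis
    proof (cases "E \<ge> \<Lambda>")
      case True
      then have E0: "E > 0" using \<Lambda> by simp
      obtain P P' P'' B where dP: "\<And>x. (P has_real_derivative P' x) (at x)" "\<And>x. (P' has_real_derivative P'' x) (at x)"
        "continuous_on UNIV P''" and bP: "\<And>x. E / 2 \<le> P x" "\<And>x. P x \<le> 3 * E / 2" "\<And>x. \<bar>P' x\<bar> \<le> B"
        and r: "\<And>x. \<bar>P x + P'' x / (4 * P x) - 5 * (P' x)\<^sup>2 / (16 * (P x)\<^sup>2) + V x - E\<bar> \<le> C * inverse E ^ K"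
        using ph[OF True] by blast
      have half: "E / 2 > 0" using E0 by simp
      obtain u u' u'' c1 c2 c3 where w:
        "\<And>x. (u has_vector_derivative u' x) (at x)" "\<And>x. (u' has_vector_derivative u'' x) (at x)"
        "continuous_on UNIV u''" "c1 > 0" "\<And>x. c1 \<le> cmod (u x)" "\<And>x. cmod (u x) \<le> c2" "\<And>x. cmod (u' x) \<le> c3"
        and e: "\<And>x. - u'' x + app_op (a1, a0) u u' x - complex_of_real E * u x =
          complex_of_real (P x + P'' x / (4 * P x) - 5 * (P' x)\<^sup>2 / (16 * (P x)\<^sup>2) + (Re (a0 x) - (Re (a1 x) / 2)\<^sup>2) - E) * u x"
        using wkb_solution[OF Q sa dP half bP, of E] by blast
      define \<eta> where "\<eta> = C * inverse E ^ K"
      have \<eta>0: "\<eta> \<ge> 0" unfolding \<eta>_def using C E0 by simp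
      have "\<delta>\<^sup>2 \<le> 2 * \<eta>\<^sup>2"
      proof (rule quasimode_bound[OF Q w])
        show "cmod (- u'' x + app_op (a1, a0) u u' x - complex_of_real E * u x) \<le> \<eta> * cmod (u x)" for x
          unfolding e norm_mult norm_of_real using r[of x, folded \<eta>_def] by (intro mult_right_mono) (simp_all add: V_def)
        show "\<delta>\<^sup>2 * sqint \<phi> \<le> sqint (\<lambda>x. f x - complex_of_real E * \<phi> x)" if "(\<phi>, f) \<in> H_op (a1, a0)" for \<phi> f
          by (rule symmetric_gap_lower_bound[OF H_op_in_L2 H_op_linear H_op_symmetric[OF assms] res \<delta> that[folded Qeq]])
      qed
      also have "\<dots> \<le> (2 * \<eta>)\<^sup>2" by (simp add: power_mult_distrib)
      finally have "\<delta> \<le> 2 * \<eta>" by (rule power2_le_imp_le) (use \<eta>0 in simp)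
      moreover have "\<eta> \<le> C * \<rho> powr (- N)"
      proof -
        have "\<rho> \<le> E" using \<rho>2 False by (simp add: E_def)
        then have "inverse E \<le> inverse \<rho>" using \<rho> by simp
        then have "inverse E ^ K \<le> inverse \<rho> ^ K" using E0 by (intro power_mono) auto
        also have "\<dots> = \<rho> powr (- real K)" using \<rho> by (simp add: powr_minus powr_realpow power_inverse)
        also have "\<dots> \<le> \<rho> powr (- N)" using \<rho> K by (intro powr_mono) auto
        finally show ?thesis unfolding \<eta>_def using C by (intro mult_left_mono) auto
      qed
      ultimately have "\<epsilon> \<le> 4 * C * \<rho> powr (- N)" by (simp add: \<delta>_def)
      also have "\<dots> < C' * \<rho> powr (- N)"
        unfolding C'_def using pw \<Lambda> by (intro mult_strict_right_mono) auto
      finally show ?thesis .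
    next
      case False
      then have E: "E < \<Lambda>" by simp
      have "0 \<le> \<rho>\<^sup>2" by simp
      then have 1: "\<epsilon> < 2 * \<Lambda>" using E unfolding E_def by linarith
      have "\<rho> \<le> \<Lambda>" using E \<rho>2 \<delta> unfolding E_def \<delta>_def by linarith
      then have "\<Lambda> powr N * \<rho> powr (- N) \<ge> \<rho> powr N * \<rho> powr (- N)"
        using \<rho> N by (intro mult_right_mono powr_mono2) auto
      then have "\<Lambda> powr N * \<rho> powr (- N) \<ge> 1" using \<rho> by (simp add: powr_add[symmetric])
      then have "2 * \<Lambda> * 1 \<le> 2 * \<Lambda> * (\<Lambda> powr N * \<rho> powr (- N))" using \<Lambda> by (intro mult_left_mono) auto
      also have "\<dots> \<le> C' * \<rho> powr (- N)"
        unfolding C'_def using C pw by (simp add: algebra_simps)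
      finally show ?thesis using 1 by simp
    qed
  qed
  then show "\<exists>C>0. \<forall>\<rho> \<epsilon>. \<rho> > 1 \<longrightarrow> spectral_gap (H_op Q) {\<rho>\<^sup>2 .. \<rho>\<^sup>2 + \<epsilon>} \<longrightarrow> \<epsilon> < C * \<rho> powr (- N)"
    using C' by blast
qed

end
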